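(* Let $E$ be a uniformly convex and uniformly smooth real Banach space, let $g(x)=\frac12\|x\|^2$ on $E$, let $C\subset E$ be nonempty, closed and convex, and let $\phi(x,y)=\|x\|^2-2\langle x,Jy\rangle+\|y\|^2$. Then $\nabla g=J$ and $D_g(x,y)=\frac12\phi(x,y)$ for all $x,y\in E$, and for a mapping $T:C\to E^*$ with $J_*T(C)\subset C$ and $F_J(T)\neq\emptyset$ the generalized Bregman $J_*$-nonexpansive condition is the generalized $J_*$-nonexpansive condition $$\phi(p,J_*Tx)\le\phi(p,x),\qquad x\in C,\ p\in F_J(T).$$ Consequently the following holds. Let $\{\Theta_l\}_{l\ge1}$ be a countable family of equilibrium bifunctions $C\times C\to\mathbb R$, $\{A_k\}_{k\ge1}$ a countable family of norm-continuous monotone mappings $C\to E^*$, and $\{T_j\}_{j\ge1}$ a countable family of $J_*$-closed mappings $C\to E^*$ with $J_*T_j(C)\subset C$, $F_J(T_j)\ne\emptyset$, satisfying the displayed condition. Assume that for all $l,k\ge1$, $x\in C$, $r>0$ the sets $\mathcal Z_r^{\Theta_l}(x)$ and $\mathcal W_r^{A_k}(x)$ are nonempty, and that $$\mathcal S:=\Big(\bigcap_{j\ge1}F_J(T_j)\Big)\cap\Big(\bigcap_{l\ge1}\operatorname{EP}(\Theta_l)\Big)\cap\Big(\bigcap_{k\ge1}\operatorname{VI}(C,A_k)\Big)\neq\emptyset.$$ Let $\alpha_1,\alpha_2,\alpha_3\in(0,1)$ with $\alpha_1+\alpha_2+\alpha_3=1$, $r_0>0$, $\{r_n\}\subset[r_0,\infty)$,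 and let $\tau_T,\tau_A,\tau_\Theta:\mathbb N\to\mathbb N$ each take every value in $\mathbb N$ infinitely often. For $x\in C$ put $x_1=x$, $C_1=C$ and, for $n\ge1$, $$\begin{cases} z_n=R_{r_n}^{\Theta_{\tau_\Theta(n)}}x_n,\\ u_n=Q_{r_n}^{A_{\tau_A(n)}}x_n,\\ y_n=J_*\big(\alpha_1Jx_n+\alpha_2Jz_n+\alpha_3J(J_*T_{\tau_T(n)}u_n)\big),\\ C_{n+1}=\{z\in C_n:\phi(z,y_n)\le\phi(z,x_n)\},\\ x_{n+1}=\operatorname*{arg\,min}_{z\in C_{n+1}}\phi(z,x).\end{cases}$$ Then $\{x_n\}$ converges strongly to the unique minimizer of $\phi(\cdot,x)$ over $\mathcal S$.
   Context: $E^*$ is the dual of $E$, $\langle\cdot,\cdot\rangle$ the duality pairing, $J:E\to E^*$ the normalized duality mapping ($\langle x,Jx\rangle=\|x\|^2=\|Jx\|^2$), which is single-valued and bijective here; $J_*:=J^{-1}$. Bregman distance: $D_g(x,y)=g(x)-g(y)-\langle\nabla g(y),x-y\rangle$. Mappings. For $T:C\to E^*$ with $J_*T(C)\subset C$, $F_J(T):=\{p\in C:Tp=Jp\}$. $T$ is generalized Bregman $J_*$-nonexpansive if $J_*T(C)\subset C$, $F_J(T)\neq\emptyset$ and $D_g(p,J_*Tx)\le D_g(p,x)$ for all $x\in C$, $p\in F_J(T)$. $T$ is $J_*$-closed if $J_*T(C)\subset C$ and whenever $x_n\to x$ in $C$ and $J_*Tx_n\to y$ in $E$, then $y=J_*Tx$.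 An equilibrium bifunction is $\Theta:C\times C\to\mathbb R$ with $\Theta(x,x)=0$; $\Theta(x,y)+\Theta(y,x)\le0$; $\limsup_{t\downarrow0}\Theta(tz+(1-t)x,y)\le\Theta(x,y)$ (for all $x,y,z\in C$); and $\Theta(x,\cdot)$ convex and lower semicontinuous on $C$ for each $x\in C$. $\operatorname{EP}(\Theta)=\{x^*\in C:\Theta(x^*,y)\ge0\ \forall y\in C\}$; $\operatorname{VI}(C,A)=\{x^*\in C:\langle y-x^*,Ax^*\rangle\ge0\ \forall y\in C\}$. Resolvents. For $r>0$, $x\in C$: $\mathcal Z_r^\Theta(x)=\{z\in C:\Theta(z,y)+\frac1r\langle y-z,Jz-Jx\rangle\ge0\ \forall y\in C\}$, $\mathcal W_r^A(x)=\{z\in C:\langle y-z,Az\rangle+\frac1r\langle y-z,Jz-Jx\rangle\ge0\ \forall y\in C\}$. When nonempty (for $\Theta$ an equilibrium bifunction, $A$ monotone) these sets are singletons, whose unique elements are denoted $R_r^\Theta x$ and $Q_r^Ax$. *)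

theory Defs
  imports "HOL-Analysis.Analysis"
begin

text \<open>The dual of a real normed space \<open>'a\<close> is the space \<open>'a \<Rightarrow>\<^sub>L real\<close> of bounded linear
  functionals with the operator norm, and \<open>blinfun_apply f x\<close> is the duality pairing of \<open>x\<close> with \<open>f\<close>.
  Mappings on a subset \<open>C\<close> are total functions of which only the values on \<open>C\<close> are ever used.\<close>

definition uniformly_convex :: "'a::real_normed_vector itself \<Rightarrow> bool" where
  "uniformly_convex _ \<longleftrightarrow>
     (\<forall>\<epsilon>>0. \<exists>\<delta>>0. \<forall>x y :: 'a. norm x = 1 \<and> norm y = 1 \<and> norm (x - y) \<ge> \<epsilon>
        \<longrightarrow> norm ((1/2) *\<^sub>R (x + y)) \<le> 1 - \<delta>)"

text \<open>This says that the modulus of smoothness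
  \<open>\<rho>(t) = sup {(\<parallel>x + y\<parallel> + \<parallel>x - y\<parallel>) / 2 - 1 | \<parallel>x\<parallel> = 1, \<parallel>y\<parallel> = t}\<close> satisfies \<open>\<rho>(t) / t \<rightarrow> 0\<close>
  as \<open>t \<rightarrow> 0\<close>.\<close>

definition uniformly_smooth :: "'a::real_normed_vector itself \<Rightarrow> bool" where
  "uniformly_smooth _ \<longleftrightarrow>
     (\<forall>\<epsilon>>0. \<exists>\<delta>>0. \<forall>x y :: 'a. norm x = 1 \<and> norm y \<le> \<delta>
        \<longrightarrow> norm (x + y) + norm (x - y) \<le> 2 + \<epsilon> * norm y)"

definition duality_set :: "'a::real_normed_vector \<Rightarrow> ('a \<Rightarrow>\<^sub>L real) set" where
  "duality_set x = {f. blinfun_apply f x = (norm x)\<^sup>2 \<and> (norm x)\<^sup>2 = (norm f)\<^sup>2}"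

text \<open>The definitions of \<open>J\<close> and \<open>Jstar\<close> are meaningful when the duality mapping is single-valued and
  bijective, as is the case on uniformly convex and uniformly smooth Banach spaces.\<close>

definition J :: "'a::real_normed_vector \<Rightarrow> ('a \<Rightarrow>\<^sub>L real)" where
  "J x = (THE f. f \<in> duality_set x)"

definition Jstar :: "('a::real_normed_vector \<Rightarrow>\<^sub>L real) \<Rightarrow> 'a" where
  "Jstar = inv J"

definition gradient :: "('a::real_normed_vector \<Rightarrow> real) \<Rightarrow> 'a \<Rightarrow> ('a \<Rightarrow>\<^sub>L real)" where
  "gradient g x = (THE f. (g has_derivative blinfun_apply f) (at x))"

definition bregman :: "('a::real_normed_vector \<Rightarrow> real) \<Rightarrow> 'a \<Rightarrow> 'a \<Rightarrow> real" where
  "bregman g x y = g x - g y - blinfun_apply (gradient g y) (x - y)"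

definition phi :: "'a::real_normed_vector \<Rightarrow> 'a \<Rightarrow> real" where
  "phi x y = (norm x)\<^sup>2 - 2 * blinfun_apply (J y) x + (norm y)\<^sup>2"

definition FJ :: "'a set \<Rightarrow> ('a::real_normed_vector \<Rightarrow> ('a \<Rightarrow>\<^sub>L real)) \<Rightarrow> 'a set" where
  "FJ C T = {p \<in> C. T p = J p}"

definition gen_bregman_nonexpansive ::
    "('a::real_normed_vector \<Rightarrow> real) \<Rightarrow> 'a set \<Rightarrow> ('a \<Rightarrow> ('a \<Rightarrow>\<^sub>L real)) \<Rightarrow> bool" where
  "gen_bregman_nonexpansive g C T \<longleftrightarrow>
     (\<forall>x\<in>C. Jstar (T x) \<in> C) \<and> FJ C T \<noteq> {} \<and>
     (\<forall>x\<in>C. \<forall>p\<in>FJ C T. bregman g p (Jstar (T x)) \<le> bregman g p x)"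

definition Jstar_closed :: "'a set \<Rightarrow> ('a::real_normed_vector \<Rightarrow> ('a \<Rightarrow>\<^sub>L real)) \<Rightarrow> bool" where
  "Jstar_closed C T \<longleftrightarrow>
     (\<forall>x\<in>C. Jstar (T x) \<in> C) \<and>
     (\<forall>X x y. (\<forall>n. X n \<in> C) \<and> x \<in> C \<and> X \<longlonglongrightarrow> x \<and> (\<lambda>n. Jstar (T (X n))) \<longlonglongrightarrow> y
        \<longrightarrow> y = Jstar (T x))"

definition monotone_mapping :: "'a set \<Rightarrow> ('a::real_normed_vector \<Rightarrow> ('a \<Rightarrow>\<^sub>L real)) \<Rightarrow> bool" where
  "monotone_mapping C A \<longleftrightarrow> (\<forall>x\<in>C. \<forall>y\<in>C. blinfun_apply (A x - A y) (x - y) \<ge> 0)"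

definition lsc_on :: "'a::topological_space set \<Rightarrow> ('a \<Rightarrow> real) \<Rightarrow> bool" where
  "lsc_on C f \<longleftrightarrow> (\<forall>x\<in>C. \<forall>a<f x. \<forall>\<^sub>F y in at x within C. a < f y)"

definition equilibrium_bifunction :: "'a::real_normed_vector set \<Rightarrow> ('a \<Rightarrow> 'a \<Rightarrow> real) \<Rightarrow> bool" where
  "equilibrium_bifunction C \<Theta> \<longleftrightarrow>
     (\<forall>x\<in>C. \<Theta> x x = 0) \<and>
     (\<forall>x\<in>C. \<forall>y\<in>C. \<Theta> x y + \<Theta> y x \<le> 0) \<and>
     (\<forall>x\<in>C. \<forall>y\<in>C. \<forall>z\<in>C.
        Limsup (at_right 0) (\<lambda>t::real. ereal (\<Theta> (t *\<^sub>R z + (1 - t) *\<^sub>R x) y)) \<le> ereal (\<Theta> x y)) \<and>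
     (\<forall>x\<in>C. convex_on C (\<Theta> x) \<and> lsc_on C (\<Theta> x))"

definition EP :: "'a set \<Rightarrow> ('a \<Rightarrow> 'a \<Rightarrow> real) \<Rightarrow> 'a set" where
  "EP C \<Theta> = {x \<in> C. \<forall>y\<in>C. \<Theta> x y \<ge> 0}"

definition VI :: "'a set \<Rightarrow> ('a::real_normed_vector \<Rightarrow> ('a \<Rightarrow>\<^sub>L real)) \<Rightarrow> 'a set" where
  "VI C A = {x \<in> C. \<forall>y\<in>C. blinfun_apply (A x) (y - x) \<ge> 0}"

text \<open>The families are indexed by the positive integers; the values at index 0 play no role.\<close>

definition common_solutions ::
    "'a set \<Rightarrow> (nat \<Rightarrow> 'a \<Rightarrow> ('a \<Rightarrow>\<^sub>L real)) \<Rightarrow> (nat \<Rightarrow> 'a \<Rightarrow> 'a \<Rightarrow> real) \<Rightarrow>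
       (nat \<Rightarrow> 'a \<Rightarrow> ('a::real_normed_vector \<Rightarrow>\<^sub>L real)) \<Rightarrow> 'a set" where
  "common_solutions C T \<Theta> A =
     (\<Inter>j\<in>{1..}. FJ C (T j)) \<inter> (\<Inter>l\<in>{1..}. EP C (\<Theta> l)) \<inter> (\<Inter>k\<in>{1..}. VI C (A k))"

definition Zset :: "'a set \<Rightarrow> ('a::real_normed_vector \<Rightarrow> 'a \<Rightarrow> real) \<Rightarrow> real \<Rightarrow> 'a \<Rightarrow> 'a set" where
  "Zset C \<Theta> r x = {z \<in> C. \<forall>y\<in>C. \<Theta> z y + (1 / r) * blinfun_apply (J z - J x) (y - z) \<ge> 0}"

definition Wset :: "'a set \<Rightarrow> ('a::real_normed_vector \<Rightarrow> ('a \<Rightarrow>\<^sub>L real)) \<Rightarrow> real \<Rightarrow> 'a \<Rightarrow> 'a set" where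
  "Wset C A r x =
     {z \<in> C. \<forall>y\<in>C. blinfun_apply (A z) (y - z) + (1 / r) * blinfun_apply (J z - J x) (y - z) \<ge> 0}"

definition resolvent_EP :: "'a set \<Rightarrow> ('a::real_normed_vector \<Rightarrow> 'a \<Rightarrow> real) \<Rightarrow> real \<Rightarrow> 'a \<Rightarrow> 'a" where
  "resolvent_EP C \<Theta> r x = (THE z. z \<in> Zset C \<Theta> r x)"

definition resolvent_VI ::
    "'a set \<Rightarrow> ('a::real_normed_vector \<Rightarrow> ('a \<Rightarrow>\<^sub>L real)) \<Rightarrow> real \<Rightarrow> 'a \<Rightarrow> 'a" where
  "resolvent_VI C A r x = (THE z. z \<in> Wset C A r x)"

end

theory Submission
  imports Defs
begin

text \<open>Smoothness makes \<open>J\<close> the derivative of half the squared norm, and uniform convexity makes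
  \<open>\<phi>(x, y)\<close> control \<open>\<parallel>x - y\<parallel>\<close> on bounded sets. Hence the minimizing sequences of
  \<open>\<parallel>x\<parallel>\<^sup>2 - 2 \<langle>x, f\<rangle>\<close> on closed convex sets are Cauchy, which yields both the surjectivity of \<open>J\<close> and
  the generalized projections without weak compactness. Since \<open>x\<^sub>n\<close> is the projection of \<open>x\<^sub>1\<close> onto
  the decreasing sets \<open>C\<^sub>n\<close>, the values \<open>\<phi>(x\<^sub>n, x\<^sub>1)\<close> increase and are bounded, and the three-point
  inequality makes \<open>x\<^sub>n\<close> Cauchy. Its limit \<open>p\<close> lies in every \<open>C\<^sub>n\<close>, so \<open>y\<^sub>n \<longrightarrow> p\<close>; the slack in
  \<open>\<phi>(q, y\<^sub>n) + \<alpha>\<^sub>2 \<phi>(z\<^sub>n, x\<^sub>n) + \<alpha>\<^sub>3 \<phi>(u\<^sub>n, x\<^sub>n) \<le> \<phi>(q, x\<^sub>n)\<close> for a common solution \<open>q\<close> then forces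
  \<open>z\<^sub>n, u\<^sub>n \<longrightarrow> p\<close>, and solving the definition of \<open>y\<^sub>n\<close> for \<open>J (J\<^sub>* T u\<^sub>n)\<close> gives
  \<open>J\<^sub>* T u\<^sub>n \<longrightarrow> p\<close>.\<close>

section \<open>Smoothness of the norm and existence of duality functionals\<close>

context
  assumes us: "uniformly_smooth TYPE('a::real_normed_vector)"
begin

text \<open>The definition speaks of unit vectors; dividing \<open>x\<close> and \<open>h\<close> by
  \<open>norm x\<close> reduces to it by homogeneity. The radius is rescaled by
  \<open>norm x\<close> and so depends on \<open>x\<close>.\<close>

lemma uniformly_smooth_norm_diff:
  fixes x :: 'a
  assumes "x \<noteq> 0" "\<epsilon> > 0"
  shows "\<exists>\<delta>>0. \<forall>h. norm h \<le> \<delta> \<longrightarrow> norm (x + h) + norm (x - h) \<le> 2 * norm x + \<epsilon> * norm h"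
proof -
  obtain \<delta> where \<delta>: "\<delta> > 0" and
    H: "\<And>x y :: 'a. norm x = 1 \<Longrightarrow> norm y \<le> \<delta> \<Longrightarrow> norm (x + y) + norm (x - y) \<le> 2 + \<epsilon> * norm y"
    using us \<open>\<epsilon> > 0\<close> unfolding uniformly_smooth_def by metis
  define c where "c = norm x"
  have c: "c > 0" using assms by (simp add: c_def)
  have "norm (x + h) + norm (x - h) \<le> 2 * norm x + \<epsilon> * norm h" if "norm h \<le> c * \<delta>" for h
  proof -
    have "norm ((1/c) *\<^sub>R x + (1/c) *\<^sub>R h) + norm ((1/c) *\<^sub>R x - (1/c) *\<^sub>R h)
        \<le> 2 + \<epsilon> * norm ((1/c) *\<^sub>R h)"
      using that c by (intro H) (auto simp: c_def field_simps)
    then have "norm (x + h) / c + norm (x - h) / c \<le> 2 + \<epsilon> * (norm h / c)"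
      using c by (simp flip: scaleR_add_right scaleR_diff_right)
    then have "c * (norm (x + h) / c + norm (x - h) / c) \<le> c * (2 + \<epsilon> * (norm h / c))"
      using c by (intro mult_left_mono) auto
    then show ?thesis using c by (simp add: c_def distrib_left)
  qed
  then show ?thesis using c \<delta> by (intro exI[of _ "c * \<delta>"]) auto
qed

text \<open>For \<open>x \<noteq> 0\<close>, with \<open>c = norm x\<close> and \<open>?a\<close>,
  \<open>?b\<close> the norms of \<open>x + h\<close> and \<open>x - h\<close>, the left side is
  \<open>(1/2) * (?a - c)\<^sup>2 + (1/2) * (?b - c)\<^sup>2 + c * (?a + ?b - 2 * c)\<close>: the
  squares are of order \<open>(norm h)\<^sup>2\<close>, and smoothness of the norm bounds the last
  term.\<close>

lemma uniformly_smooth_half_square_diff: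
  fixes x :: 'a
  assumes "\<epsilon> > 0"
  shows "\<exists>\<delta>>0. \<forall>h. norm h \<le> \<delta> \<longrightarrow>
           (1/2) * (norm (x + h))\<^sup>2 + (1/2) * (norm (x - h))\<^sup>2 - (norm x)\<^sup>2 \<le> \<epsilon> * norm h"
proof (cases "x = 0")
  case True
  have "(norm h)\<^sup>2 \<le> \<epsilon> * norm h" if "norm h \<le> \<epsilon>" for h :: 'a
    using that by (simp add: power2_eq_square mult_right_mono)
  with True assms show ?thesis by (intro exI[of _ \<epsilon>]) auto
next
  case False
  define c where "c = norm x"
  have c: "c > 0" using False by (simp add: c_def)
  \<comment> \<open>The tolerance \<open>\<epsilon> / (2 * c)\<close> is later multiplied by
    \<open>c\<close> and costs half of \<open>\<epsilon>\<close>; the other half absorbs the squares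
    through \<open>norm h \<le> \<epsilon> / 2\<close>.\<close>
  obtain \<delta> where \<delta>: "\<delta> > 0"
    and H: "\<And>h. norm h \<le> \<delta> \<Longrightarrow> norm (x + h) + norm (x - h) \<le> 2 * c + \<epsilon> / (2 * c) * norm h"
    using uniformly_smooth_norm_diff[OF False, of "\<epsilon> / (2 * c)"] assms c unfolding c_def by auto
  have "(1/2) * (norm (x + h))\<^sup>2 + (1/2) * (norm (x - h))\<^sup>2 - (norm x)\<^sup>2 \<le> \<epsilon> * norm h"
    if h: "norm h \<le> min \<delta> (\<epsilon> / 2)" for h
  proof -
    let ?a = "norm (x + h)" and ?b = "norm (x - h)"
    have "\<bar>?a - c\<bar> \<le> norm h" "\<bar>?b - c\<bar> \<le> norm h"
      unfolding c_def using norm_triangle_ineq3[of "x + h" x] norm_triangle_ineq3[of "x - h" x] by auto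
    then have sq: "(?a - c)\<^sup>2 \<le> (norm h)\<^sup>2" "(?b - c)\<^sup>2 \<le> (norm h)\<^sup>2"
      by (metis abs_norm_cancel abs_le_square_iff)+
    have "c * (?a + ?b - 2 * c) \<le> c * (\<epsilon> / (2 * c) * norm h)"
      using H[of h] h c by (intro mult_left_mono) auto
    moreover have "c * (\<epsilon> / (2 * c) * norm h) = (\<epsilon> / 2) * norm h" using c by simp
    moreover have "(norm h)\<^sup>2 \<le> (\<epsilon> / 2) * norm h"
      unfolding power2_eq_square using h by (intro mult_right_mono) auto
    moreover have "(1/2) * ?a\<^sup>2 + (1/2) * ?b\<^sup>2 - c\<^sup>2
        = (1/2) * (?a - c)\<^sup>2 + (1/2) * (?b - c)\<^sup>2 + c * (?a + ?b - 2 * c)"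
      by (simp add: power2_eq_square field_simps)
    ultimately show ?thesis using sq by (simp add: c_def)
  qed
  then show ?thesis using \<delta> assms by (intro exI[of _ "min \<delta> (\<epsilon> / 2)"]) auto
qed

text \<open>The one-sided directional derivative of the norm is sublinear; smoothness forces it to be odd,
  hence linear, so that no Hahn--Banach theorem is needed.\<close>

lemma norm_subgradient_exists:
  fixes x :: 'a
  assumes "x \<noteq> 0"
  shows "\<exists>f :: 'a \<Rightarrow>\<^sub>L real. \<forall>h. norm x + blinfun_apply f h \<le> norm (x + h)"
proof -
  \<comment> \<open>By convexity of the norm, \<open>q h t\<close> is nondecreasing in
    \<open>t > 0\<close>, so the infimum \<open>p h\<close> is the right derivative of the norm at
    \<open>x\<close> in direction \<open>h\<close>; working with the infimum avoids a limit.\<close>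
  define q where "q h t = (norm (x + t *\<^sub>R h) - norm x) / t" for h and t :: real
  define p where "p h = (INF t\<in>{0<..}. q h t)" for h
  have q_bounds: "\<bar>q h t\<bar> \<le> norm h" if "t > 0" for h t
  proof -
    have "\<bar>norm (x + t *\<^sub>R h) - norm x\<bar> \<le> t * norm h"
      using norm_triangle_ineq3[of "x + t *\<^sub>R h" x] that by simp
    then show ?thesis using that by (simp add: q_def abs_divide field_simps)
  qed
  have bdd: "bdd_below (q h ` {0<..})" for h
    using q_bounds[of _ h] by (intro bdd_belowI[of _ "- norm h"]) (force simp: abs_le_iff)
  have p_le: "p h \<le> q h t" if "t > 0" for h t
    unfolding p_def using that bdd by (intro cINF_lower) auto
  have p_ge: "a \<le> p h" if "\<And>t. t > 0 \<Longrightarrow> a \<le> q h t" for a h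
    unfolding p_def using that by (intro cINF_greatest) auto
  have p_abs: "\<bar>p h\<bar> \<le> norm h" for h
  proof -
    have "- norm h \<le> p h" using q_bounds[of _ h] by (intro p_ge) (simp add: abs_le_iff, smt (verit))
    moreover have "p h \<le> norm h" using p_le[of 1 h] q_bounds[of 1 h] by simp
    ultimately show ?thesis by simp
  qed
  \<comment> \<open>The step \<open>s * t / (s + t)\<close> makes the point in direction
    \<open>h + k\<close> the convex combination, with weights \<open>?l\<close> and
    \<open>?m\<close>, of the points reached with steps \<open>s\<close> and \<open>t\<close>. As
    \<open>s\<close> and \<open>t\<close> are independent, the two infima can be taken one after the
    other.\<close>
  have q_add: "q (h + k) (s * t / (s + t)) \<le> q h s + q k t" if st: "s > 0" "t > 0" for h k s t
  proof -
    let ?l = "t / (s + t)" and ?m = "s / (s + t)"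
    have lm: "?l + ?m = 1" "?l \<ge> 0" "?m \<ge> 0" using st by (auto simp: add_divide_distrib[symmetric])
    have "x = (?l + ?m) *\<^sub>R x" by (simp only: lm scaleR_one)
    then have "x + (s * t / (s + t)) *\<^sub>R (h + k) = ?l *\<^sub>R (x + s *\<^sub>R h) + ?m *\<^sub>R (x + t *\<^sub>R k)"
      by (simp add: algebra_simps)
    then have "norm (x + (s * t / (s + t)) *\<^sub>R (h + k))
        \<le> ?l * norm (x + s *\<^sub>R h) + ?m * norm (x + t *\<^sub>R k)"
      using norm_triangle_ineq[of "?l *\<^sub>R (x + s *\<^sub>R h)" "?m *\<^sub>R (x + t *\<^sub>R k)"] lm st by simp
    moreover have "norm x = ?l * norm x + ?m * norm x"
      by (metis lm(1) distrib_right mult_1)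
    ultimately have "norm (x + (s * t / (s + t)) *\<^sub>R (h + k)) - norm x
        \<le> ?l * (norm (x + s *\<^sub>R h) - norm x) + ?m * (norm (x + t *\<^sub>R k) - norm x)"
      by (simp only: right_diff_distrib)
    then have "q (h + k) (s * t / (s + t)) \<le>
      (?l * (norm (x + s *\<^sub>R h) - norm x) + ?m * (norm (x + t *\<^sub>R k) - norm x)) / (s * t / (s + t))"
      unfolding q_def using st by (intro divide_right_mono) auto
    also have "\<dots> = q h s + q k t"
      unfolding q_def using st by (simp add: divide_simps)
    finally show ?thesis .
  qed
  have p_subadd: "p (h + k) \<le> p h + p k" for h k
  proof -
    have "p (h + k) \<le> q h s + q k t" if "s > 0" "t > 0" for s t
      using p_le[of "s * t / (s + t)" "h + k"] q_add[OF that, of h k] that by (simp add: order_trans)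
    then have "p (h + k) - q h s \<le> p k" if "s > 0" for s
      using that by (intro p_ge) (auto simp: algebra_simps)
    then have "p (h + k) - p k \<le> p h" by (intro p_ge) (auto simp: algebra_simps)
    then show ?thesis by simp
  qed
  have p_0: "p 0 = 0" using p_abs[of 0] by simp
  have p_odd: "p (- h) = - p h" for h
  proof -
    have "p h + p (- h) \<le> 0 + e" if "e > 0" for e
    proof -
      define \<epsilon> where "\<epsilon> = e / (norm h + 1)"
      have \<epsilon>: "\<epsilon> > 0" using that by (simp add: \<epsilon>_def add_nonneg_pos)
      obtain \<delta> where \<delta>: "\<delta> > 0"
        and H: "\<And>k. norm k \<le> \<delta> \<Longrightarrow> norm (x + k) + norm (x - k) \<le> 2 * norm x + \<epsilon> * norm k"
        using uniformly_smooth_norm_diff[OF assms \<epsilon>] by auto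
      define t where "t = \<delta> / (norm h + 1)"
      have t: "t > 0" using \<delta> by (simp add: t_def add_nonneg_pos)
      have "norm (t *\<^sub>R h) \<le> t * (norm h + 1)" using t by simp
      also have "\<dots> = \<delta>" using add_nonneg_pos[of "norm h" 1] by (simp add: t_def)
      finally have "norm (x + t *\<^sub>R h) + norm (x - t *\<^sub>R h) \<le> 2 * norm x + \<epsilon> * (t * norm h)"
        using H[of "t *\<^sub>R h"] t by simp
      then have "q h t + q (- h) t \<le> \<epsilon> * norm h"
        using t by (simp add: q_def add_divide_distrib[symmetric] divide_le_eq algebra_simps)
      moreover have "\<epsilon> * norm h \<le> e"
        using that by (simp add: \<epsilon>_def divide_le_eq add_nonneg_pos)
      ultimately show ?thesis using p_le[OF t, of h] p_le[OF t, of "- h"] by simp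
    qed
    then have "p h + p (- h) \<le> 0" by (rule field_le_epsilon)
    then show ?thesis using p_subadd[of h "- h"] p_0 by simp
  qed
  \<comment> \<open>Oddness turns subadditivity at \<open>- h\<close>, \<open>- k\<close> into
    superadditivity.\<close>
  have p_add: "p (h + k) = p h + p k" for h k
    using p_subadd[of h k] p_subadd[of "- h" "- k"] p_odd[of "h + k"] p_odd[of h] p_odd[of k] by simp
  have p_pos_le: "p (c *\<^sub>R h) \<le> c * p h" if "c > 0" for c h
  proof -
    have "p (c *\<^sub>R h) / c \<le> p h"
    proof (rule p_ge)
      fix t :: real assume t: "t > 0"
      have "q (c *\<^sub>R h) (t / c) = c * q h t" using that t by (simp add: q_def)
      then show "p (c *\<^sub>R h) / c \<le> q h t"
        using p_le[of "t / c" "c *\<^sub>R h"] that t by (simp add: divide_le_eq mult.commute)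
    qed
    then show ?thesis using that by (simp add: divide_le_eq mult.commute)
  qed
  have p_pos: "p (c *\<^sub>R h) = c * p h" if "c > 0" for c h
    using p_pos_le[OF that, of h] p_pos_le[of "1 / c" "c *\<^sub>R h"] that by (simp add: field_simps)
  have p_scale: "p (c *\<^sub>R h) = c * p h" for c h
  proof (cases c "0 :: real" rule: linorder_cases)
    case less
    then show ?thesis using p_pos[of "- c" h] p_odd[of "(- c) *\<^sub>R h"] by simp
  qed (use p_0 p_pos in auto)
  have "bounded_linear p"
    using p_abs by (intro bounded_linear_intro[where K = 1]) (auto simp: p_add p_scale)
  then have "blinfun_apply (Blinfun p) = p" by (rule bounded_linear_Blinfun_apply)
  moreover have "norm x + p h \<le> norm (x + h)" for h
    using p_le[of 1 h] by (simp add: q_def)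
  ultimately show ?thesis by (intro exI[of _ "Blinfun p"]) simp
qed

text \<open>A subgradient of the norm at \<open>x \<noteq> 0\<close> has norm one and takes the
  value \<open>norm x\<close> at \<open>x\<close>; multiplied by \<open>norm x\<close> it is a
  duality functional.\<close>

lemma duality_set_nonempty: "\<exists>f. f \<in> duality_set (x :: 'a)"
proof (cases "x = 0")
  case True
  then show ?thesis by (auto simp: duality_set_def intro!: exI[of _ 0])
next
  case False
  then obtain f :: "'a \<Rightarrow>\<^sub>L real" where f: "\<And>h. norm x + blinfun_apply f h \<le> norm (x + h)"
    using norm_subgradient_exists by blast
  have f_le: "blinfun_apply f h \<le> norm h" for h
    using f[of h] norm_triangle_ineq[of x h] by simp
  have fx: "blinfun_apply f x = norm x"
    using f[of "- x"] f_le[of x] by (simp add: blinfun.minus_right)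
  have "norm f \<le> 1"
  proof (rule norm_blinfun_bound)
    show "norm (blinfun_apply f h) \<le> 1 * norm h" for h
      using f_le[of h] f_le[of "- h"] by (simp add: blinfun.minus_right)
  qed simp
  moreover have "norm x \<le> norm f * norm x" using norm_blinfun[of f x] fx by simp
  ultimately have "norm f = 1" using False by simp
  then have "norm x *\<^sub>R f \<in> duality_set x"
    using fx by (simp add: duality_set_def blinfun.scaleR_left power2_eq_square)
  then show ?thesis ..
qed

end

section \<open>The duality mapping as the gradient of half the squared norm\<close>

lemma duality_set_subgradient:
  assumes "f \<in> duality_set x"
  shows "blinfun_apply f h \<le> (1/2) * (norm (x + h))\<^sup>2 - (1/2) * (norm x)\<^sup>2"
proof -
  have f: "blinfun_apply f x = (norm x)\<^sup>2" "norm f = norm x"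
    using assms by (auto simp: duality_set_def)
  have "blinfun_apply f (x + h) \<le> norm x * norm (x + h)"
    using norm_blinfun[of f "x + h"] f by simp
  moreover have "0 \<le> (norm x - norm (x + h))\<^sup>2" by simp
  ultimately show ?thesis using f by (simp add: blinfun.add_right power2_eq_square algebra_simps)
qed

text \<open>The bound is free of \<open>r\<close>, so the perturbation terms of the resolvent
  inequalities vanish in the limit however the parameters vary above
  \<open>r\<^sub>0\<close>.\<close>

lemma scaled_J_diff_le:
  fixes x z :: "'a::real_normed_vector"
  assumes "0 < r\<^sub>0" "r\<^sub>0 \<le> r"
  shows "(1 / r) * blinfun_apply (J z - J x) v \<le> (1 / r\<^sub>0) * (norm (J z - J x) * norm v)"
proof -
  have "(1 / r) * blinfun_apply (J z - J x) v \<le> (1 / r) * (norm (J z - J x) * norm v)"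
    using norm_blinfun[of "J z - J x" v] assms by (intro mult_left_mono) auto
  also have "\<dots> \<le> (1 / r\<^sub>0) * (norm (J z - J x) * norm v)"
    using assms by (intro mult_right_mono) (auto simp: frac_le)
  finally show ?thesis .
qed

context
  assumes us: "uniformly_smooth TYPE('a::real_normed_vector)"
begin

text \<open>By the subgradient inequality the remainders at \<open>h\<close> and \<open>- h\<close>
  are both nonnegative. Their sum is the symmetric second difference, in which the linear terms
  cancel, so it bounds each of them.\<close>

lemma duality_set_remainder:
  fixes x :: 'a
  assumes "\<epsilon> > 0"
  shows "\<exists>\<delta>>0. \<forall>f\<in>duality_set x. \<forall>h. norm h \<le> \<delta> \<longrightarrow>
           (1/2) * (norm (x + h))\<^sup>2 - (1/2) * (norm x)\<^sup>2 - blinfun_apply f h \<le> \<epsilon> * norm h"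
proof -
  obtain \<delta> where "\<delta> > 0" and H: "\<And>h. norm h \<le> \<delta> \<Longrightarrow>
      (1/2) * (norm (x + h))\<^sup>2 + (1/2) * (norm (x - h))\<^sup>2 - (norm x)\<^sup>2 \<le> \<epsilon> * norm h"
    using uniformly_smooth_half_square_diff[OF us assms, of x] by blast
  moreover have "(1/2) * (norm (x + h))\<^sup>2 - (1/2) * (norm x)\<^sup>2 - blinfun_apply f h
      \<le> (1/2) * (norm (x + h))\<^sup>2 + (1/2) * (norm (x - h))\<^sup>2 - (norm x)\<^sup>2"
    if "f \<in> duality_set x" for f h
    using duality_set_subgradient[OF that, of "- h"] by (simp add: blinfun.minus_right)
  ultimately show ?thesis by (meson order_trans)
qed

lemma duality_set_has_derivative:
  fixes x :: 'a
  assumes f: "f \<in> duality_set x"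
  shows "((\<lambda>x. (1/2) * (norm x)\<^sup>2) has_derivative blinfun_apply f) (at x)"
  unfolding has_derivative_at_alt
proof (intro conjI allI impI)
  show "bounded_linear (blinfun_apply f)" by (rule blinfun.bounded_linear_right)
  fix e :: real assume "e > 0"
  then obtain \<delta> where \<delta>: "\<delta> > 0" and H: "\<And>h. norm h \<le> \<delta> \<Longrightarrow>
      (1/2) * (norm (x + h))\<^sup>2 - (1/2) * (norm x)\<^sup>2 - blinfun_apply f h \<le> e * norm h"
    using duality_set_remainder f by meson
  have "norm ((1/2) * (norm y)\<^sup>2 - (1/2) * (norm x)\<^sup>2 - blinfun_apply f (y - x)) \<le> e * norm (y - x)"
    if "norm (y - x) < \<delta>" for y
    using H[of "y - x"] duality_set_subgradient[OF f, of "y - x"] that by simp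
  with \<delta> show "\<exists>d>0. \<forall>y. norm (y - x) < d \<longrightarrow>
      norm ((1/2) * (norm y)\<^sup>2 - (1/2) * (norm x)\<^sup>2 - blinfun_apply f (y - x)) \<le> e * norm (y - x)"
    by blast
qed

text \<open>Every duality functional is the derivative of half the squared norm, and derivatives are
  unique; hence the description defining \<open>J\<close> picks the only member.\<close>

lemma J_in_duality_set: "J (x :: 'a) \<in> duality_set x"
proof -
  obtain f where f: "f \<in> duality_set x" using duality_set_nonempty[OF us] by blast
  have "f' = f" if "f' \<in> duality_set x" for f'
    using has_derivative_unique[OF duality_set_has_derivative[OF f] duality_set_has_derivative[OF that]]
    by (simp add: blinfun_apply_inject)
  with f show ?thesis unfolding J_def by (metis theI)
qed

lemma J_self: "blinfun_apply (J (x :: 'a)) x = (norm x)\<^sup>2"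
  and norm_J: "norm (J x) = norm x"
  using J_in_duality_set[of x] by (auto simp: duality_set_def)

lemma J_le: "blinfun_apply (J (x :: 'a)) h \<le> norm x * norm h"
  using norm_blinfun[of "J x" h] norm_J[of x] by simp

lemma gradient_half_square: "gradient (\<lambda>x. (1/2) * (norm x)\<^sup>2) (x :: 'a) = J x"
  unfolding gradient_def
proof (rule the_equality)
  show J: "((\<lambda>x. (1/2) * (norm x)\<^sup>2) has_derivative blinfun_apply (J x)) (at x)"
    by (intro duality_set_has_derivative J_in_duality_set)
  show "f = J x" if "((\<lambda>x. (1/2) * (norm x)\<^sup>2) has_derivative blinfun_apply f) (at x)" for f
    using has_derivative_unique[OF that J] by (simp add: blinfun_apply_inject)
qed

lemma bregman_half_square: "bregman (\<lambda>x. (1/2) * (norm x)\<^sup>2) (x :: 'a) y = (1/2) * phi x y"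
  unfolding bregman_def gradient_half_square phi_def
  by (simp add: blinfun.diff_right J_self algebra_simps)

section \<open>The functional \<open>phi\<close> and continuity of \<open>J\<close>\<close>

lemma phi_ge: "(norm x - norm y)\<^sup>2 \<le> phi (x :: 'a) y"
  using J_le[of y x] unfolding phi_def by (simp add: power2_eq_square algebra_simps)

lemma phi_nonneg: "0 \<le> phi (x :: 'a) y"
  using phi_ge[of x y] by (meson order_trans zero_le_power2)

lemma phi_self: "phi (x :: 'a) x = 0"
  by (simp add: phi_def J_self)

text \<open>This identity turns a variational inequality
  \<open>blinfun_apply (J z - J x) (v - z) \<ge> 0\<close> into the Pythagorean inequality
  \<open>phi v z + phi z x \<le> phi v x\<close>.\<close>

lemma phi_three_point:
  "phi (v :: 'a) x = phi v z + phi z x + 2 * blinfun_apply (J z - J x) (v - z)"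
  unfolding phi_def
  by (simp add: blinfun.diff_left blinfun.diff_right J_self algebra_simps)

lemma phi_symmetric_sum: "phi (x :: 'a) y + phi y x = 2 * blinfun_apply (J x - J y) (x - y)"
  unfolding phi_def
  by (simp add: blinfun.diff_left blinfun.diff_right J_self algebra_simps)

text \<open>The subgradient inequality at \<open>X n\<close>, tested at \<open>x + h\<close>, is
  compared with the expansion at \<open>x\<close>. The latter's remainder is uniform over
  \<open>norm h = \<delta>\<close>, and \<open>c n\<close> collects the vanishing error of replacing
  \<open>X n\<close> by \<open>x\<close>; this bounds the operator norm.\<close>

lemma J_tendsto:
  assumes X: "X \<longlonglongrightarrow> (x :: 'a)"
  shows "(\<lambda>n. J (X n)) \<longlonglongrightarrow> J x"
proof (rule LIMSEQ_I)
  fix e :: real assume e: "e > 0"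
  obtain \<delta> where \<delta>: "\<delta> > 0" and H: "\<And>h. norm h \<le> \<delta> \<Longrightarrow>
      (1/2) * (norm (x + h))\<^sup>2 - (1/2) * (norm x)\<^sup>2 - blinfun_apply (J x) h \<le> (e / 3) * norm h"
    using duality_set_remainder[of "e / 3" x] J_in_duality_set[of x] e by auto
  define c where "c n = (1/2) * (norm x)\<^sup>2 - (1/2) * (norm (X n))\<^sup>2 + norm (X n) * norm (X n - x)" for n
  have "c \<longlonglongrightarrow> (1/2) * (norm x)\<^sup>2 - (1/2) * (norm x)\<^sup>2 + norm x * norm (x - x)"
    unfolding c_def by (intro tendsto_intros X)
  then have "\<forall>\<^sub>F n in sequentially. c n < \<delta> * (e / 3)"
    using \<delta> e by (intro order_tendstoD) auto
  then obtain N where N: "\<And>n. n \<ge> N \<Longrightarrow> c n < \<delta> * (e / 3)"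
    unfolding eventually_sequentially by blast
  have "norm (J (X n) - J x) < e" if "n \<ge> N" for n
  proof -
    have bound: "blinfun_apply (J (X n) - J x) h \<le> \<delta> * (2 * e / 3)" if h: "norm h = \<delta>" for h
    proof -
      have "blinfun_apply (J (X n)) (x + h - X n) \<le> (1/2) * (norm (x + h))\<^sup>2 - (1/2) * (norm (X n))\<^sup>2"
        using duality_set_subgradient[OF J_in_duality_set, of "X n" "x + h - X n"] by simp
      then have "blinfun_apply (J (X n)) h \<le> (1/2) * (norm (x + h))\<^sup>2 - (1/2) * (norm (X n))\<^sup>2
          + blinfun_apply (J (X n)) (X n - x)"
        by (simp add: blinfun.add_right blinfun.diff_right)
      then have "blinfun_apply (J (X n) - J x) h \<le> c n + (e / 3) * \<delta>"
        using H[of h] J_le[of "X n" "X n - x"] h by (simp add: c_def blinfun.diff_left)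
      then show ?thesis using N[OF \<open>n \<ge> N\<close>] by (simp add: algebra_simps)
    qed
    have "norm (J (X n) - J x) \<le> 2 * e / 3"
    proof (rule norm_blinfun_bound)
      fix h :: 'a
      show "norm (blinfun_apply (J (X n) - J x) h) \<le> 2 * e / 3 * norm h"
      proof (cases "h = 0")
        case False
        define s where "s = \<delta> / norm h"
        have s: "s > 0" "\<delta> = s * norm h" using False \<delta> by (auto simp: s_def)
        then have "s * blinfun_apply (J (X n) - J x) h \<le> s * (2 * e / 3 * norm h)"
            "s * - blinfun_apply (J (X n) - J x) h \<le> s * (2 * e / 3 * norm h)"
          using bound[of "s *\<^sub>R h"] bound[of "s *\<^sub>R (- h)"]
          by (simp_all add: blinfun.scaleR_right blinfun.minus_right algebra_simps)
        with s(1) show ?thesis by (simp only: mult_le_cancel_left_pos real_norm_def abs_le_iff)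
      qed simp
    qed (use e in simp)
    then show ?thesis using e by simp
  qed
  then show "\<exists>N. \<forall>n\<ge>N. norm (J (X n) - J x) < e" by blast
qed

text \<open>First-order optimality: minimality is tested at \<open>x + t *\<^sub>R h\<close> on the
  segment from \<open>x\<close> to \<open>v\<close> and expanded by the derivative
  \<open>J x\<close>; division by \<open>t\<close> leaves an arbitrarily small error.\<close>

lemma variational_inequality_of_min:
  fixes S :: "'a set"
  assumes S: "convex S" "x \<in> S" "v \<in> S"
    and min: "\<And>w. w \<in> S \<Longrightarrow> (norm x)\<^sup>2 - 2 * blinfun_apply f x \<le> (norm w)\<^sup>2 - 2 * blinfun_apply f w"
  shows "0 \<le> blinfun_apply (J x - f) (v - x)"
proof -
  have "- e \<le> blinfun_apply (J x - f) (v - x)" if "e > 0" for e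
  proof -
    define h where "h = v - x"
    define \<epsilon> where "\<epsilon> = e / (norm h + 1)"
    have h: "norm h + 1 > 0" by (simp add: add_nonneg_pos)
    then have \<epsilon>: "\<epsilon> > 0" "\<epsilon> * norm h \<le> e" using that by (auto simp: \<epsilon>_def divide_le_eq)
    obtain \<delta> where \<delta>: "\<delta> > 0" and H: "\<And>h. norm h \<le> \<delta> \<Longrightarrow>
        (1/2) * (norm (x + h))\<^sup>2 - (1/2) * (norm x)\<^sup>2 - blinfun_apply (J x) h \<le> \<epsilon> * norm h"
      using duality_set_remainder[OF \<epsilon>(1), of x] J_in_duality_set[of x] by auto
    define t where "t = min 1 (\<delta> / (norm h + 1))"
    have t: "t > 0" "t \<le> 1" using \<delta> h by (auto simp: t_def)
    have "t * (norm h + 1) \<le> \<delta> / (norm h + 1) * (norm h + 1)"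
      using h by (intro mult_right_mono) (auto simp: t_def)
    also have "\<dots> = \<delta>" using h by simp
    finally have "norm (t *\<^sub>R h) \<le> \<delta>" using t by (simp add: algebra_simps)
    from H[OF this] have "(1/2) * (norm (x + t *\<^sub>R h))\<^sup>2 - (1/2) * (norm x)\<^sup>2 - t * blinfun_apply (J x) h
        \<le> t * (\<epsilon> * norm h)"
      using t by (simp add: blinfun.scaleR_right algebra_simps)
    moreover have "x + t *\<^sub>R h = (1 - t) *\<^sub>R x + t *\<^sub>R v" by (simp add: h_def algebra_simps)
    then have "x + t *\<^sub>R h \<in> S" using S t by (simp add: convexD)
    from min[OF this] have "(1/2) * (norm x)\<^sup>2 \<le> (1/2) * (norm (x + t *\<^sub>R h))\<^sup>2 - t * blinfun_apply f h"
      by (simp add: blinfun.add_right blinfun.scaleR_right)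
    ultimately have "t * - (\<epsilon> * norm h) \<le> t * blinfun_apply (J x - f) h"
      by (simp add: blinfun.diff_left algebra_simps)
    then have "- (\<epsilon> * norm h) \<le> blinfun_apply (J x - f) h"
      using t(1) by (simp only: mult_le_cancel_left_pos)
    with \<epsilon>(2) show ?thesis by (simp add: h_def)
  qed
  then have "0 \<le> blinfun_apply (J x - f) (v - x) + e" if "e > 0" for e using that by fastforce
  then show ?thesis by (rule field_le_epsilon)
qed

lemma phi_tendsto:
  fixes X Y :: "nat \<Rightarrow> 'a"
  assumes "X \<longlonglongrightarrow> a" "Y \<longlonglongrightarrow> b"
  shows "(\<lambda>n. phi (X n) (Y n)) \<longlonglongrightarrow> phi a b"
  unfolding phi_def
  by (intro tendsto_add tendsto_diff tendsto_mult tendsto_power tendsto_norm tendsto_const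
      blinfun.tendsto J_tendsto assms)

text \<open>In the second argument \<open>phi v\<close> is affine in the dual vector apart from the
  squared norm, and \<open>norm y = norm (J y)\<close> makes that term convex in the dual
  vector.\<close>

lemma phi_J_convex_combination:
  fixes y :: 'a
  assumes y: "J y = a *\<^sub>R J b + a' *\<^sub>R J b' + a'' *\<^sub>R J b''"
    and a: "a \<ge> 0" "a' \<ge> 0" "a'' \<ge> 0" "a + a' + a'' = 1"
  shows "phi v y \<le> a * phi v b + a' * phi v b' + a'' * phi v b''"
proof -
  define m where "m = a * norm b + a' * norm b' + a'' * norm b''"
  have "norm y \<le> m"
    using norm_triangle_ineq[of "a *\<^sub>R J b + a' *\<^sub>R J b'" "a'' *\<^sub>R J b''"]
      norm_triangle_ineq[of "a *\<^sub>R J b" "a' *\<^sub>R J b'"] a y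
    by (simp add: m_def flip: norm_J)
  then have "(norm y)\<^sup>2 \<le> m\<^sup>2" by (simp add: power_mono)
  also have "m\<^sup>2 \<le> a * (norm b)\<^sup>2 + a' * (norm b')\<^sup>2 + a'' * (norm b'')\<^sup>2"
  proof -
    \<comment> \<open>Jensen's inequality for the square, as nonnegativity of the weighted variance
      about the mean \<open>m\<close>.\<close>
    have "0 \<le> a * (norm b - m)\<^sup>2 + a' * (norm b' - m)\<^sup>2 + a'' * (norm b'' - m)\<^sup>2"
      using a by simp
    also have "\<dots> = a * (norm b)\<^sup>2 + a' * (norm b')\<^sup>2 + a'' * (norm b'')\<^sup>2
        - 2 * m * (a * norm b + a' * norm b' + a'' * norm b'') + (a + a' + a'') * m\<^sup>2"
      by (simp add: power2_eq_square algebra_simps)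
    also have "\<dots> = a * (norm b)\<^sup>2 + a' * (norm b')\<^sup>2 + a'' * (norm b'')\<^sup>2 - m\<^sup>2"
      unfolding a(4) m_def[symmetric] by (simp add: power2_eq_square)
    finally show ?thesis by simp
  qed
  finally have "phi v y \<le> (a + a' + a'') * (norm v)\<^sup>2 - 2 * blinfun_apply (J y) v
      + (a * (norm b)\<^sup>2 + a' * (norm b')\<^sup>2 + a'' * (norm b'')\<^sup>2)"
    by (simp add: phi_def a(4))
  also have "\<dots> = a * phi v b + a' * phi v b' + a'' * phi v b''"
    unfolding y phi_def by (simp add: blinfun.add_left blinfun.scaleR_left algebra_simps)
  finally show ?thesis .
qed

text \<open>The term \<open>(norm v)\<^sup>2\<close> cancels and leaves a condition linear in
  \<open>v\<close>; this keeps the sets of the iteration closed and convex.\<close>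

lemma phi_le_phi_halfspace:
  "{v :: 'a. phi v b \<le> phi v a}
    = blinfun_apply (J a - J b) -` {..((norm a)\<^sup>2 - (norm b)\<^sup>2) / 2}"
  by (auto simp: phi_def blinfun.diff_left)

lemma closed_phi_le_phi: "closed {v :: 'a. phi v b \<le> phi v a}"
  unfolding phi_le_phi_halfspace
  by (intro closed_vimage closed_atMost linear_continuous_on blinfun.bounded_linear_right)

lemma convex_phi_le_phi: "convex {v :: 'a. phi v b \<le> phi v a}"
  unfolding phi_le_phi_halfspace
  by (intro convex_linear_vimage convex_real_interval bounded_linear.linear blinfun.bounded_linear_right)

section \<open>Estimates for resolvents and their limits\<close>

lemma scaled_J_diff_tendsto_0:
  fixes X Z :: "nat \<Rightarrow> 'a"
  assumes "Z \<longlonglongrightarrow> l" "X \<longlonglongrightarrow> l"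
  shows "(\<lambda>n. c * (norm (J (Z n) - J (X n)) * norm (v - Z n))) \<longlonglongrightarrow> 0"
proof -
  have "(\<lambda>n. c * (norm (J (Z n) - J (X n)) * norm (v - Z n))) \<longlonglongrightarrow> c * (norm (J l - J l) * norm (v - l))"
    by (intro tendsto_mult tendsto_norm tendsto_diff tendsto_const J_tendsto assms)
  then show ?thesis by simp
qed

text \<open>Testing the resolvent inequality with \<open>p\<close> and using
  \<open>\<Theta> z p \<le> - \<Theta> p z \<le> 0\<close> leaves a variational inequality for
  \<open>J\<close>, to which the three-point identity applies.\<close>

lemma phi_Zset_le:
  fixes C :: "'a set"
  assumes \<Theta>: "equilibrium_bifunction C \<Theta>" and "r > 0"
    and z: "z \<in> Zset C \<Theta> r x" and p: "p \<in> EP C \<Theta>"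
  shows "phi p z + phi z x \<le> phi p x"
proof -
  have C: "z \<in> C" "p \<in> C" using z p by (auto simp: Zset_def EP_def)
  have "0 \<le> \<Theta> z p + (1 / r) * blinfun_apply (J z - J x) (p - z)" using z C by (simp add: Zset_def)
  moreover have "0 \<le> \<Theta> p z" using p C by (simp add: EP_def)
  moreover have "\<Theta> z p + \<Theta> p z \<le> 0" using \<Theta> C by (simp add: equilibrium_bifunction_def)
  ultimately have "0 \<le> (1 / r) * blinfun_apply (J z - J x) (p - z)" by linarith
  then have "0 \<le> blinfun_apply (J z - J x) (p - z)" using \<open>r > 0\<close> by (simp add: zero_le_divide_iff)
  then show ?thesis using phi_three_point[of p x z] by simp
qed

lemma phi_Wset_le:
  fixes C :: "'a set"
  assumes A: "monotone_mapping C A" and "r > 0"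
    and z: "z \<in> Wset C A r x" and p: "p \<in> VI C A"
  shows "phi p z + phi z x \<le> phi p x"
proof -
  have C: "z \<in> C" "p \<in> C" using z p by (auto simp: Wset_def VI_def)
  have "0 \<le> blinfun_apply (A z) (p - z) + (1 / r) * blinfun_apply (J z - J x) (p - z)"
    using z C by (simp add: Wset_def)
  moreover have "0 \<le> blinfun_apply (A p) (z - p)" using p C by (simp add: VI_def)
  moreover have "0 \<le> blinfun_apply (A z - A p) (z - p)" using A C by (simp add: monotone_mapping_def)
  then have "blinfun_apply (A z) (p - z) + blinfun_apply (A p) (z - p) \<le> 0"
    by (simp add: blinfun.diff_left blinfun.diff_right)
  ultimately have "0 \<le> (1 / r) * blinfun_apply (J z - J x) (p - z)" by linarith
  then have "0 \<le> blinfun_apply (J z - J x) (p - z)" using \<open>r > 0\<close> by (simp add: zero_le_divide_iff)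
  then show ?thesis using phi_three_point[of p x z] by simp
qed

text \<open>Minty's argument: monotonicity and lower semicontinuity first yield
  \<open>\<Theta> y l \<le> 0\<close> for all \<open>y\<close> in \<open>C\<close>; convexity on the
  segment from \<open>l\<close> to \<open>y\<close> and upper hemicontinuity at \<open>l\<close>
  then reverse this to \<open>\<Theta> l y \<ge> 0\<close>.\<close>

lemma limit_of_resolvents_in_EP:
  fixes C :: "'a set" and R :: "nat \<Rightarrow> real"
  assumes \<Theta>: "equilibrium_bifunction C \<Theta>" and C: "convex C" "l \<in> C"
    and r: "0 < r\<^sub>0" "\<And>n. r\<^sub>0 \<le> R n"
    and Z: "\<And>n. Z n \<in> Zset C \<Theta> (R n) (X n)" "Z \<longlonglongrightarrow> l" and X: "X \<longlonglongrightarrow> l"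
  shows "l \<in> EP C \<Theta>"
proof -
  have le0: "\<Theta> y l \<le> 0" if y: "y \<in> C" for y
  proof (rule ccontr)
    assume "\<not> \<Theta> y l \<le> 0"
    then have pos: "0 < \<Theta> y l / 2" "\<Theta> y l / 2 < \<Theta> y l" by auto
    have "lsc_on C (\<Theta> y)" using \<Theta> y by (simp add: equilibrium_bifunction_def)
    then have "\<forall>\<^sub>F v in at l within C. \<Theta> y l / 2 < \<Theta> y v"
      using C(2) pos(2) unfolding lsc_on_def by blast
    \<comment> \<open>The filter \<open>at l within C\<close> omits \<open>l\<close>, where the
      strict inequality holds as well; adding the point allows composition with \<open>Z\<close>,
      which may take the value \<open>l\<close>.\<close>
    then have "\<forall>\<^sub>F v in nhds l. v \<in> C \<longrightarrow> \<Theta> y l / 2 < \<Theta> y v"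
      unfolding eventually_at_filter using pos(2) by (auto elim!: eventually_mono)
    then have "\<forall>\<^sub>F n in sequentially. Z n \<in> C \<longrightarrow> \<Theta> y l / 2 < \<Theta> y (Z n)"
      by (rule eventually_compose_filterlim[OF _ Z(2)])
    moreover have "\<forall>\<^sub>F n in sequentially.
        (1 / r\<^sub>0) * (norm (J (Z n) - J (X n)) * norm (y - Z n)) < \<Theta> y l / 2"
      by (rule order_tendstoD(2)[OF scaled_J_diff_tendsto_0[OF Z(2) X] pos(1)])
    ultimately have "\<forall>\<^sub>F n in sequentially. False"
    proof eventually_elim
      case (elim n)
      have ZC: "Z n \<in> C" using Z(1)[of n] by (simp add: Zset_def)
      have "0 \<le> \<Theta> (Z n) y + (1 / R n) * blinfun_apply (J (Z n) - J (X n)) (y - Z n)"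
        using Z(1)[of n] y by (simp add: Zset_def)
      moreover have "\<Theta> (Z n) y + \<Theta> y (Z n) \<le> 0"
        using \<Theta> ZC y by (simp add: equilibrium_bifunction_def)
      ultimately show False
        using elim ZC scaled_J_diff_le[OF r(1) r(2)[of n], of "Z n" "X n" "y - Z n"] by linarith
    qed
    then show False by simp
  qed
  have "0 \<le> \<Theta> l y" if y: "y \<in> C" for y
  proof -
    have ge0: "0 \<le> \<Theta> (t *\<^sub>R y + (1 - t) *\<^sub>R l) y" if t: "0 < t" "t < 1" for t
    proof -
      let ?w = "t *\<^sub>R y + (1 - t) *\<^sub>R l"
      have w: "?w \<in> C" using C y t by (intro convexD) auto
      have "convex_on C (\<Theta> ?w)" using \<Theta> w by (simp add: equilibrium_bifunction_def)
      \<comment> \<open>Convexity bounds \<open>\<Theta> ?w ?w = 0\<close> by two terms; the one at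
        \<open>l\<close> is nonpositive by \<open>le0\<close>, so the one at \<open>y\<close> is
        nonnegative.\<close>
      from convex_onD[OF this, of t l y] have "\<Theta> ?w ?w \<le> (1 - t) * \<Theta> ?w l + t * \<Theta> ?w y"
        using t y C by (simp add: add.commute)
      moreover have "\<Theta> ?w ?w = 0" using \<Theta> w by (simp add: equilibrium_bifunction_def)
      moreover have "(1 - t) * \<Theta> ?w l \<le> 0" using le0[OF w] t by (simp add: mult_nonneg_nonpos)
      ultimately have "0 \<le> t * \<Theta> ?w y" by linarith
      then show ?thesis using t by (simp add: zero_le_mult_iff)
    qed
    have "\<forall>\<^sub>F t in at_right (0::real). 0 \<le> ereal (\<Theta> (t *\<^sub>R y + (1 - t) *\<^sub>R l) y)"
      by (rule eventually_mono[OF eventually_at_right_real[of 0 1]]) (auto intro: ge0)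
    then have "0 \<le> Limsup (at_right 0) (\<lambda>t::real. ereal (\<Theta> (t *\<^sub>R y + (1 - t) *\<^sub>R l) y))"
      by (intro le_Limsup) auto
    also have "\<dots> \<le> ereal (\<Theta> l y)" using \<Theta> y C by (simp add: equilibrium_bifunction_def)
    finally show ?thesis by simp
  qed
  with C show ?thesis by (simp add: EP_def)
qed

text \<open>Norm continuity of \<open>A\<close> lets the resolvent inequality pass to the limit
  directly, once its perturbation term is replaced by the bound \<open>?e n\<close>, which is free
  of \<open>R n\<close> and tends to zero.\<close>

lemma limit_of_resolvents_in_VI:
  fixes C :: "'a set" and R :: "nat \<Rightarrow> real"
  assumes A: "continuous_on C A" and C: "l \<in> C"
    and r: "0 < r\<^sub>0" "\<And>n. r\<^sub>0 \<le> R n"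
    and Z: "\<And>n. Z n \<in> Wset C A (R n) (X n)" "Z \<longlonglongrightarrow> l" and X: "X \<longlonglongrightarrow> l"
  shows "l \<in> VI C A"
proof -
  have ZC: "Z n \<in> C" for n using Z(1)[of n] by (simp add: Wset_def)
  have "0 \<le> blinfun_apply (A l) (y - l)" if y: "y \<in> C" for y
  proof -
    let ?e = "\<lambda>n. (1 / r\<^sub>0) * (norm (J (Z n) - J (X n)) * norm (y - Z n))"
    have "(\<lambda>n. A (Z n)) \<longlonglongrightarrow> A l"
      by (rule continuous_on_tendsto_compose[OF A Z(2) C]) (simp add: ZC)
    then have "(\<lambda>n. blinfun_apply (A (Z n)) (y - Z n) + ?e n) \<longlonglongrightarrow> blinfun_apply (A l) (y - l) + 0"
      by (intro tendsto_add blinfun.tendsto tendsto_diff tendsto_const Z(2) scaled_J_diff_tendsto_0[OF Z(2) X])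
    moreover have "0 \<le> blinfun_apply (A (Z n)) (y - Z n) + ?e n" for n
    proof -
      have "0 \<le> blinfun_apply (A (Z n)) (y - Z n) + (1 / R n) * blinfun_apply (J (Z n) - J (X n)) (y - Z n)"
        using Z(1)[of n] y by (simp add: Wset_def)
      then show ?thesis
        using scaled_J_diff_le[OF r(1) r(2)[of n], of "Z n" "X n" "y - Z n"] by linarith
    qed
    ultimately show ?thesis using LIMSEQ_le_const[of _ _ 0] by fastforce
  qed
  with C show ?thesis by (simp add: VI_def)
qed

end

section \<open>Uniform convexity: strict monotonicity of \<open>J\<close> and uniqueness of
  resolvents\<close>

context
  assumes us: "uniformly_smooth TYPE('a::real_normed_vector)"
    and uc: "uniformly_convex TYPE('a)"
begin

text \<open>If \<open>x\<close> and \<open>y\<close> are far apart while \<open>\<parallel>x\<parallel>\<close> and \<open>\<parallel>y\<parallel>\<close> are close, uniform convexity bounds the norm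
  of the sum of their normalizations \<open>x / \<parallel>x\<parallel>\<close> and \<open>y / \<parallel>y\<parallel>\<close>, and testing it against \<open>J y\<close>
  bounds \<open>\<langle>x, J y\<rangle>\<close> away from \<open>\<parallel>x\<parallel> \<parallel>y\<parallel>\<close>.\<close>

lemma phi_small_imp_close:
  assumes "\<epsilon> > 0"
  shows "\<exists>\<delta>>0. \<forall>x y :: 'a. norm y \<le> M \<and> phi x y < \<delta> \<longrightarrow> norm (x - y) < \<epsilon>"
proof -
  define K where "K = max M 1"
  have K: "K > 0" "M \<le> K" by (auto simp: K_def)
  \<comment> \<open>The threshold is the separation left to the normalized vectors: the difference
    of the norms uses up less than a quarter of \<open>\<epsilon>\<close>, and the rest is divided
    by \<open>K\<close>, an upper bound of \<open>norm y\<close>.\<close>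
  obtain d where d: "d > 0" and D: "\<And>x y :: 'a. norm x = 1 \<Longrightarrow> norm y = 1 \<Longrightarrow>
      norm (x - y) \<ge> 3 * \<epsilon> / (4 * K) \<Longrightarrow> norm ((1/2) *\<^sub>R (x + y)) \<le> 1 - d"
  proof -
    have "3 * \<epsilon> / (4 * K) > 0" using assms K by simp
    from uc[unfolded uniformly_convex_def, rule_format, OF this] show ?thesis using that by blast
  qed
  \<comment> \<open>The first entry gives \<open>\<bar>a - b\<bar> < \<epsilon> / 4\<close> through
    \<open>phi_ge\<close>, whence both norms are at least \<open>3 / 8 * \<epsilon>\<close>. The
    second equals \<open>4 * d * (3 / 8 * \<epsilon>)\<^sup>2\<close>, the lower bound for
    \<open>phi x y\<close> that produces the contradiction.\<close>
  define \<delta> where "\<delta> = min ((\<epsilon> / 4)\<^sup>2) (9 / 16 * d * \<epsilon>\<^sup>2)"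
  have "norm (x - y) < \<epsilon>" if y: "norm y \<le> M" and phi: "phi x y < \<delta>" for x y :: 'a
  proof (rule ccontr)
    assume "\<not> norm (x - y) < \<epsilon>"
    then have far: "\<epsilon> \<le> norm (x - y)" by simp
    define a b where "a = norm x" and "b = norm y"
    have "(a - b)\<^sup>2 < (\<epsilon> / 4)\<^sup>2" using phi_ge[OF us, of x y] phi by (simp add: \<delta>_def a_def b_def)
    then have ab: "\<bar>a - b\<bar> < \<epsilon> / 4" using assms power2_less_imp_less[of "\<bar>a - b\<bar>" "\<epsilon> / 4"] by simp
    have "\<epsilon> \<le> a + b" using far norm_triangle_ineq4[of x y] by (simp add: a_def b_def)
    with ab assms have a: "a \<ge> 3 / 8 * \<epsilon>" and b: "b \<ge> 3 / 8 * \<epsilon>" by linarith+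
    with assms have pos: "a > 0" "b > 0" by linarith+
    have bK: "b \<le> K" using y K by (simp add: b_def)
    define x' y' where "x' = (1 / a) *\<^sub>R x" and "y' = (1 / b) *\<^sub>R y"
    have unit: "norm x' = 1" "norm y' = 1" using pos by (auto simp: x'_def y'_def a_def b_def)
    have "x = a *\<^sub>R x'" "y = b *\<^sub>R y'" using pos by (auto simp: x'_def y'_def)
    then have "x - y = (a - b) *\<^sub>R x' + b *\<^sub>R (x' - y')" by (simp add: algebra_simps)
    then have "norm (x - y) \<le> \<bar>a - b\<bar> + b * norm (x' - y')"
      using norm_triangle_ineq[of "(a - b) *\<^sub>R x'" "b *\<^sub>R (x' - y')"] unit pos by simp
    with far ab have "3 / 4 * \<epsilon> \<le> b * norm (x' - y')" by simp
    also have "\<dots> \<le> K * norm (x' - y')" using bK by (simp add: mult_right_mono)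
    finally have "3 * \<epsilon> / (4 * K) \<le> norm (x' - y')" using K by (simp add: field_simps)
    from D[OF unit this] have "norm (x' + y') \<le> 2 * (1 - d)" by simp
    then have "b * norm (x' + y') \<le> b * (2 * (1 - d))" using pos by (intro mult_left_mono) auto
    then have "blinfun_apply (J y) (x' + y') \<le> b * (2 * (1 - d))"
      using J_le[OF us, of y "x' + y'"] by (simp add: b_def)
    then have "blinfun_apply (J y) x / a + b \<le> b * (2 * (1 - d))"
      using pos by (simp add: x'_def y'_def blinfun.add_right blinfun.scaleR_right J_self[OF us]
          power2_eq_square flip: b_def)
    then have "a * (blinfun_apply (J y) x / a + b) \<le> a * (b * (2 * (1 - d)))"
      using pos by (intro mult_left_mono) auto
    then have "blinfun_apply (J y) x \<le> a * b - 2 * (d * (a * b))"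
      using pos by (simp add: algebra_simps)
    moreover have "phi x y = (a - b)\<^sup>2 + 2 * (a * b - blinfun_apply (J y) x)"
      by (simp add: phi_def a_def b_def power2_eq_square algebra_simps)
    then have "2 * (a * b - blinfun_apply (J y) x) \<le> phi x y" by simp
    ultimately have "4 * (d * (a * b)) \<le> phi x y" by simp
    moreover have "(3 / 8 * \<epsilon>) * (3 / 8 * \<epsilon>) \<le> a * b" using a b assms by (intro mult_mono) auto
    then have "4 * (d * ((3 / 8 * \<epsilon>) * (3 / 8 * \<epsilon>))) \<le> 4 * (d * (a * b))"
      using d by (intro mult_left_mono) auto
    moreover have "4 * (d * ((3 / 8 * \<epsilon>) * (3 / 8 * \<epsilon>))) = 9 / 16 * d * \<epsilon>\<^sup>2"
      by (simp add: power2_eq_square)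
    moreover have "phi x y < 9 / 16 * d * \<epsilon>\<^sup>2" using phi by (simp add: \<delta>_def)
    ultimately show False by linarith
  qed
  moreover have "\<delta> > 0" using assms d by (simp add: \<delta>_def)
  ultimately show ?thesis by blast
qed

lemma phi_tendsto_0_imp_diff_tendsto_0:
  fixes X Y :: "nat \<Rightarrow> 'a"
  assumes "(\<lambda>n. phi (X n) (Y n)) \<longlonglongrightarrow> 0" and "Bseq Y"
  shows "(\<lambda>n. X n - Y n) \<longlonglongrightarrow> 0"
proof (rule LIMSEQ_I)
  fix e :: real assume "e > 0"
  obtain M where M: "\<And>n. norm (Y n) \<le> M" using \<open>Bseq Y\<close> unfolding Bseq_def by blast
  obtain \<delta> where "\<delta> > 0" and \<delta>: "\<And>x y :: 'a. norm y \<le> M \<Longrightarrow> phi x y < \<delta> \<Longrightarrow> norm (x - y) < e"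
    using phi_small_imp_close[OF \<open>e > 0\<close>] by blast
  have "\<forall>\<^sub>F n in sequentially. phi (X n) (Y n) < \<delta>"
    using order_tendstoD(2)[OF assms(1) \<open>\<delta> > 0\<close>] .
  then show "\<exists>N. \<forall>n\<ge>N. norm (X n - Y n - 0) < e"
    unfolding eventually_sequentially diff_zero using \<delta> M by meson
qed

lemma phi_tendsto_0_imp_tendsto:
  fixes X Y :: "nat \<Rightarrow> 'a"
  assumes "(\<lambda>n. phi (X n) (Y n)) \<longlonglongrightarrow> 0" and "Y \<longlonglongrightarrow> l"
  shows "X \<longlonglongrightarrow> l"
proof -
  have "Bseq Y" using assms(2) by (intro convergent_imp_Bseq convergentI)
  from tendsto_add[OF phi_tendsto_0_imp_diff_tendsto_0[OF assms(1) this] assms(2)] show ?thesis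
    by (simp only: diff_add_cancel add_0)
qed

lemma phi_eq_0_iff: "phi (x :: 'a) y = 0 \<longleftrightarrow> x = y"
proof
  assume "phi x y = 0"
  then have "(\<lambda>n. x) \<longlonglongrightarrow> y"
    using phi_tendsto_0_imp_tendsto[of "\<lambda>n. x" "\<lambda>n. y" y] by simp
  then show "x = y" by (simp add: LIMSEQ_const_iff)
qed (simp add: phi_self[OF us])

text \<open>The pairing is half of \<open>phi x y + phi y x\<close>; both summands are nonnegative,
  hence zero.\<close>

lemma J_monotone_strict:
  assumes "blinfun_apply (J x - J y) (x - y) \<le> 0"
  shows "x = (y :: 'a)"
  using phi_symmetric_sum[OF us, of x y] phi_nonneg[OF us, of x y] phi_nonneg[OF us, of y x] assms
    phi_eq_0_iff[of x y] by linarith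

text \<open>Here the limit is known for the first argument, so boundedness of \<open>Y\<close> must
  first be extracted from
  \<open>(norm (X n) - norm (Y n))\<^sup>2 \<le> phi (X n) (Y n)\<close>.\<close>

lemma phi_tendsto_0_imp_tendsto_right:
  fixes X Y :: "nat \<Rightarrow> 'a"
  assumes phi: "(\<lambda>n. phi (X n) (Y n)) \<longlonglongrightarrow> 0" and X: "X \<longlonglongrightarrow> l"
  shows "Y \<longlonglongrightarrow> l"
proof -
  have "(\<lambda>n. (norm (X n) - norm (Y n))\<^sup>2) \<longlonglongrightarrow> 0"
    by (rule tendsto_sandwich[OF _ _ tendsto_const phi]) (auto simp: phi_ge[OF us])
  then have "(\<lambda>n. norm (X n) - norm (Y n)) \<longlonglongrightarrow> 0" by simp
  from tendsto_diff[OF tendsto_norm[OF X] this] have "(\<lambda>n. norm (Y n)) \<longlonglongrightarrow> norm l" by simp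
  then have "Bseq (\<lambda>n. norm (Y n))" by (intro convergent_imp_Bseq convergentI)
  then have "Bseq Y" by (simp add: Bseq_def)
  from tendsto_diff[OF X phi_tendsto_0_imp_diff_tendsto_0[OF phi this]]
  show ?thesis by simp
qed

text \<open>Uniqueness: the inequalities of two members, each tested with the other, are added;
  monotonicity removes \<open>\<Theta>\<close>, and strict monotonicity of \<open>J\<close> makes
  the members equal.\<close>

lemma resolvent_EP_in_Zset:
  fixes C :: "'a set"
  assumes \<Theta>: "equilibrium_bifunction C \<Theta>" and "r > 0" and ne: "Zset C \<Theta> r x \<noteq> {}"
  shows "resolvent_EP C \<Theta> r x \<in> Zset C \<Theta> r x"
proof -
  have "a = b" if a: "a \<in> Zset C \<Theta> r x" and b: "b \<in> Zset C \<Theta> r x" for a b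
  proof (rule J_monotone_strict)
    have C: "a \<in> C" "b \<in> C" using a b by (auto simp: Zset_def)
    then have "0 \<le> \<Theta> a b + (1 / r) * blinfun_apply (J a - J x) (b - a)"
        "0 \<le> \<Theta> b a + (1 / r) * blinfun_apply (J b - J x) (a - b)"
      using a b by (auto simp: Zset_def)
    moreover have "\<Theta> a b + \<Theta> b a \<le> 0" using \<Theta> C by (simp add: equilibrium_bifunction_def)
    ultimately have "0 \<le> (1 / r) * (blinfun_apply (J a - J x) (b - a) + blinfun_apply (J b - J x) (a - b))"
      unfolding distrib_left by linarith
    then have "0 \<le> blinfun_apply (J a - J x) (b - a) + blinfun_apply (J b - J x) (a - b)"
      using \<open>r > 0\<close> by (simp add: zero_le_divide_iff)
    then show "blinfun_apply (J a - J b) (a - b) \<le> 0"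
      by (simp add: blinfun.diff_left blinfun.diff_right)
  qed
  with ne show ?thesis unfolding resolvent_EP_def by (metis ex_in_conv theI)
qed

lemma resolvent_VI_in_Wset:
  fixes C :: "'a set"
  assumes A: "monotone_mapping C A" and "r > 0" and ne: "Wset C A r x \<noteq> {}"
  shows "resolvent_VI C A r x \<in> Wset C A r x"
proof -
  have "a = b" if a: "a \<in> Wset C A r x" and b: "b \<in> Wset C A r x" for a b
  proof (rule J_monotone_strict)
    have C: "a \<in> C" "b \<in> C" using a b by (auto simp: Wset_def)
    then have "0 \<le> blinfun_apply (A a) (b - a) + (1 / r) * blinfun_apply (J a - J x) (b - a)"
        "0 \<le> blinfun_apply (A b) (a - b) + (1 / r) * blinfun_apply (J b - J x) (a - b)"
      using a b by (auto simp: Wset_def)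
    moreover have "0 \<le> blinfun_apply (A a - A b) (a - b)" using A C by (simp add: monotone_mapping_def)
    then have "blinfun_apply (A a) (b - a) + blinfun_apply (A b) (a - b) \<le> 0"
      by (simp add: blinfun.diff_left blinfun.diff_right)
    ultimately have "0 \<le> (1 / r) * (blinfun_apply (J a - J x) (b - a) + blinfun_apply (J b - J x) (a - b))"
      unfolding distrib_left by linarith
    then have "0 \<le> blinfun_apply (J a - J x) (b - a) + blinfun_apply (J b - J x) (a - b)"
      using \<open>r > 0\<close> by (simp add: zero_le_divide_iff)
    then show "blinfun_apply (J a - J b) (a - b) \<le> 0"
      by (simp add: blinfun.diff_left blinfun.diff_right)
  qed
  with ne show ?thesis unfolding resolvent_VI_def by (metis ex_in_conv theI)
qed

end

section \<open>Completeness: minimizers, surjectivity of \<open>J\<close> and generalized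
  projections\<close>

context
  assumes us: "uniformly_smooth TYPE('a::banach)"
    and uc: "uniformly_convex TYPE('a)"
begin

text \<open>With \<open>\<psi>\<close> the minimized function and \<open>m\<close> the midpoint of \<open>u\<close> and \<open>v\<close>, both \<open>\<psi> u + \<psi> v - 2 \<psi> m\<close> and
  \<open>\<phi>(u, m) + \<phi>(v, m)\<close> equal \<open>\<parallel>u\<parallel>\<^sup>2 + \<parallel>v\<parallel>\<^sup>2 - 2 \<parallel>m\<parallel>\<^sup>2\<close>, so minimizing
  sequences are Cauchy.\<close>

lemma square_minus_linear_attains_min:
  fixes S :: "'a set"
  assumes S: "S \<noteq> {}" "closed S" "convex S"
  shows "\<exists>x\<in>S. \<forall>v\<in>S. (norm x)\<^sup>2 - 2 * blinfun_apply f x \<le> (norm v)\<^sup>2 - 2 * blinfun_apply f v"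
proof -
  define \<psi> where "\<psi> x = (norm x)\<^sup>2 - 2 * blinfun_apply f x" for x :: 'a
  \<comment> \<open>Completing the square bounds \<open>\<psi>\<close> from below, so its infimum is
    finite, and bounds its sublevel sets, hence the minimizing sequence.\<close>
  have \<psi>_ge: "(norm v - norm f)\<^sup>2 - (norm f)\<^sup>2 \<le> \<psi> v" for v
    using norm_blinfun[of f v] by (simp add: \<psi>_def power2_eq_square algebra_simps)
  then have "- (norm f)\<^sup>2 \<le> \<psi> v" for v
    using zero_le_power2[of "norm v - norm f"] by (smt (verit))
  then have bdd: "bdd_below (\<psi> ` S)" by (intro bdd_belowI[of _ "- (norm f)\<^sup>2"]) auto
  define d where "d = (INF v\<in>S. \<psi> v)"
  have d_le: "d \<le> \<psi> v" if "v \<in> S" for v unfolding d_def using bdd that by (rule cINF_lower)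
  have "\<exists>v\<in>S. \<psi> v < d + 1 / Suc n" for n
    using cINF_less_iff[OF S(1) bdd, of "d + 1 / Suc n"] by (simp add: d_def)
  then obtain X where X: "\<And>n. X n \<in> S" "\<And>n. \<psi> (X n) < d + 1 / Suc n" by metis
  define M where "M = norm f + sqrt (d + 1 + (norm f)\<^sup>2)"
  have bound: "norm (X n) \<le> M" for n
  proof -
    have "1 / real (Suc n) \<le> 1" by simp
    then have "(norm (X n) - norm f)\<^sup>2 \<le> d + 1 + (norm f)\<^sup>2" using \<psi>_ge[of "X n"] X(2)[of n] by linarith
    then have "\<bar>norm (X n) - norm f\<bar> \<le> sqrt (d + 1 + (norm f)\<^sup>2)" by (metis real_le_rsqrt power2_abs)
    then show ?thesis by (simp add: M_def)
  qed
  have mid: "phi u ((1/2) *\<^sub>R (u + v)) + phi v ((1/2) *\<^sub>R (u + v)) = \<psi> u + \<psi> v - 2 * \<psi> ((1/2) *\<^sub>R (u + v))"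
    for u v :: 'a
  proof -
    define m where "m = (1/2) *\<^sub>R (u + v)"
    have "u + v = 2 *\<^sub>R m" by (simp add: m_def)
    then have "blinfun_apply (J m) u + blinfun_apply (J m) v = 2 * (norm m)\<^sup>2"
        "blinfun_apply f u + blinfun_apply f v = 2 * blinfun_apply f m"
      by (metis blinfun.add_right blinfun.scaleR_right J_self[OF us] real_scaleR_def)+
    then show ?thesis by (simp add: phi_def \<psi>_def flip: m_def)
  qed
  have "Cauchy X"
  proof (rule CauchyI)
    fix e :: real assume "e > 0"
    obtain \<delta> where \<delta>: "\<delta> > 0" "\<And>x y :: 'a. norm y \<le> M \<Longrightarrow> phi x y < \<delta> \<Longrightarrow> norm (x - y) < e / 2"
      using phi_small_imp_close[OF us uc, of "e / 2"] \<open>e > 0\<close> by (meson half_gt_zero)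
    obtain N where N: "1 / Suc N < \<delta> / 2" using \<delta>(1) by (meson half_gt_zero nat_approx_posE)
    have "norm (X k - X n) < e" if kn: "k \<ge> N" "n \<ge> N" for k n
    proof -
      define m where "m = (1/2) *\<^sub>R (X k + X n)"
      have "m \<in> S" unfolding m_def scaleR_add_right using X(1) by (intro convexD[OF S(3)]) auto
      then have "2 * d \<le> 2 * \<psi> m" using d_le by simp
      moreover have "1 / Suc k \<le> 1 / Suc N" "1 / Suc n \<le> 1 / Suc N" using kn by (auto simp: frac_le)
      ultimately have "phi (X k) m + phi (X n) m < \<delta>"
        using mid[of "X k" "X n"] X(2)[of k] X(2)[of n] N unfolding m_def by linarith
      then have "phi (X k) m < \<delta>" "phi (X n) m < \<delta>"
        using phi_nonneg[OF us, of "X k" m] phi_nonneg[OF us, of "X n" m] by linarith+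
      moreover have "norm m \<le> M"
        using norm_triangle_ineq[of "X k" "X n"] bound[of k] bound[of n] by (simp add: m_def)
      ultimately have "norm (X k - m) < e / 2" "norm (X n - m) < e / 2" using \<delta>(2) by auto
      then show ?thesis by (rule norm_triangle_half_l)
    qed
    then show "\<exists>N. \<forall>k\<ge>N. \<forall>n\<ge>N. norm (X k - X n) < e" by blast
  qed
  then obtain p where p: "X \<longlonglongrightarrow> p" by (auto simp: Cauchy_convergent_iff convergent_def)
  have "p \<in> S" using closed_sequentially[OF S(2)] X(1) p by blast
  have "(\<lambda>n. \<psi> (X n)) \<longlonglongrightarrow> \<psi> p"
    unfolding \<psi>_def by (intro tendsto_intros p)
  moreover have "(\<lambda>n. d + 1 / Suc n) \<longlonglongrightarrow> d + 0"
    by (intro tendsto_intros LIMSEQ_Suc lim_1_over_n)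
  ultimately have "\<psi> p \<le> d + 0"
    using X(2) by (intro LIMSEQ_le) (auto intro: less_imp_le)
  then show ?thesis using \<open>p \<in> S\<close> d_le unfolding \<psi>_def by force
qed

text \<open>At a minimizer over the whole space the variational inequality holds in the directions
  \<open>h\<close> and \<open>- h\<close>, so \<open>J x - f\<close> vanishes.\<close>

lemma surj_J: "surj (J :: 'a \<Rightarrow> _)"
proof -
  have "\<exists>x :: 'a. J x = f" for f
  proof -
    obtain x :: 'a where min: "\<And>v. (norm x)\<^sup>2 - 2 * blinfun_apply f x \<le> (norm v)\<^sup>2 - 2 * blinfun_apply f v"
      using square_minus_linear_attains_min[of UNIV f] by auto
    have "0 \<le> blinfun_apply (J x - f) h" for h
      using variational_inequality_of_min[OF us, of UNIV x "x + h" f] min by simp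
    then have "blinfun_apply (J x - f) h = 0" for h
      by (metis blinfun.minus_right neg_0_le_iff_le antisym)
    then have "J x - f = 0" by (intro blinfun_eqI) simp
    then show ?thesis by (intro exI[of _ x]) simp
  qed
  then show ?thesis by (metis surjI)
qed

lemma J_Jstar: "J (Jstar f :: 'a) = f"
  unfolding Jstar_def by (rule surj_f_inv_f[OF surj_J])

text \<open>Continuity of the inverse of \<open>J\<close>: \<open>phi (X n) x\<close> is at most the
  symmetric sum of \<open>phi\<close>, which the dual distance controls. \<open>c\<close> is written
  with dual norms because their convergence is what is given.\<close>

lemma tendsto_of_J_tendsto:
  fixes X :: "nat \<Rightarrow> 'a"
  assumes "(\<lambda>n. J (X n)) \<longlonglongrightarrow> J x"
  shows "X \<longlonglongrightarrow> x"
proof -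
  define c where "c n = 2 * (norm (J (X n) - J x) * (norm (J (X n)) + norm (J x)))" for n
  have "c \<longlonglongrightarrow> 2 * (norm (J x - J x) * (norm (J x) + norm (J x)))"
    unfolding c_def by (intro tendsto_intros assms)
  then have c: "c \<longlonglongrightarrow> 0" by simp
  have le: "phi (X n) x \<le> c n" for n
  proof -
    have "blinfun_apply (J (X n) - J x) (X n - x) \<le> norm (J (X n) - J x) * norm (X n - x)"
      using norm_blinfun[of "J (X n) - J x" "X n - x"] by simp
    also have "\<dots> \<le> norm (J (X n) - J x) * (norm (X n) + norm x)"
      by (intro mult_left_mono norm_triangle_ineq4) simp
    finally show ?thesis
      using phi_symmetric_sum[OF us, of "X n" x] phi_nonneg[OF us, of x "X n"]
      by (simp add: c_def norm_J[OF us])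
  qed
  have "(\<lambda>n. phi (X n) x) \<longlonglongrightarrow> 0"
    by (rule tendsto_sandwich[OF _ _ tendsto_const c]) (auto simp: phi_nonneg[OF us] le)
  then show ?thesis by (rule phi_tendsto_0_imp_tendsto[OF us uc]) simp
qed

text \<open>\<open>phi v a\<close> differs from the function minimized above by the constant
  \<open>(norm a)\<^sup>2\<close>, so a minimizer exists and the choice in \<open>arg_min_on\<close>
  returns one. Its variational inequality and the three-point identity give the Pythagorean
  inequality.\<close>

lemma arg_min_phi:
  fixes S :: "'a set" and a :: 'a
  assumes S: "S \<noteq> {}" "closed S" "convex S"
  defines "x \<equiv> arg_min_on (\<lambda>v. phi v a) S"
  shows "x \<in> S" and "\<And>v. v \<in> S \<Longrightarrow> phi v x + phi x a \<le> phi v a"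
proof -
  obtain w where w: "w \<in> S"
      "\<And>v. v \<in> S \<Longrightarrow> (norm w)\<^sup>2 - 2 * blinfun_apply (J a) w \<le> (norm v)\<^sup>2 - 2 * blinfun_apply (J a) v"
    using square_minus_linear_attains_min[OF S, of "J a"] by blast
  have "phi w a \<le> phi v a" if "v \<in> S" for v using w(2)[OF that] by (simp add: phi_def)
  then have "is_arg_min (\<lambda>v. phi v a) (\<lambda>v. v \<in> S) w"
    using w(1) by (simp add: is_arg_min_linorder)
  then have "is_arg_min (\<lambda>v. phi v a) (\<lambda>v. v \<in> S) x"
    unfolding x_def arg_min_on_def arg_min_def
    by (rule someI[of "is_arg_min (\<lambda>v. phi v a) (\<lambda>v. v \<in> S)"])
  then have "x \<in> S \<and> (\<forall>v. v \<in> S \<longrightarrow> phi x a \<le> phi v a)"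
    unfolding is_arg_min_linorder by blast
  then have "x \<in> S" and x: "\<And>v. v \<in> S \<Longrightarrow> phi x a \<le> phi v a" by blast+
  have min: "(norm x)\<^sup>2 - 2 * blinfun_apply (J a) x \<le> (norm v)\<^sup>2 - 2 * blinfun_apply (J a) v"
    if "v \<in> S" for v
    using x[OF that] unfolding phi_def by linarith
  show "x \<in> S" by fact
  show "phi v x + phi x a \<le> phi v a" if "v \<in> S" for v
    using variational_inequality_of_min[OF us S(3) \<open>x \<in> S\<close> that min] phi_three_point[OF us, of v a x]
    by linarith
qed

section \<open>Strong convergence of the hybrid projection iteration\<close>

lemma hybrid_projection_tendsto:
  fixes C :: "'a set" and \<Theta> :: "nat \<Rightarrow> 'a \<Rightarrow> 'a \<Rightarrow> real" and A T :: "nat \<Rightarrow> 'a \<Rightarrow> ('a \<Rightarrow>\<^sub>L real)"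
    and x z u y :: "nat \<Rightarrow> 'a" and r :: "nat \<Rightarrow> real" and Cs :: "nat \<Rightarrow> 'a set" and a\<^sub>1 a\<^sub>2 a\<^sub>3 :: real
    and \<tau>\<^sub>T \<tau>\<^sub>A \<tau>\<^sub>\<Theta> :: "nat \<Rightarrow> nat"
  defines "S \<equiv> common_solutions C T \<Theta> A"
  assumes C: "closed C" "convex C"
    and \<Theta>: "\<And>l. l \<ge> 1 \<Longrightarrow> equilibrium_bifunction C (\<Theta> l)"
    and A: "\<And>k. k \<ge> 1 \<Longrightarrow> continuous_on C (A k)" "\<And>k. k \<ge> 1 \<Longrightarrow> monotone_mapping C (A k)"
    and T_closed: "\<And>j. j \<ge> 1 \<Longrightarrow> Jstar_closed C (T j)"
    and T_phi: "\<And>j v p. j \<ge> 1 \<Longrightarrow> v \<in> C \<Longrightarrow> p \<in> FJ C (T j) \<Longrightarrow> phi p (Jstar (T j v)) \<le> phi p v"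
    and Z_ne: "\<And>l v s. l \<ge> 1 \<Longrightarrow> v \<in> C \<Longrightarrow> s > 0 \<Longrightarrow> Zset C (\<Theta> l) s v \<noteq> {}"
    and W_ne: "\<And>k v s. k \<ge> 1 \<Longrightarrow> v \<in> C \<Longrightarrow> s > 0 \<Longrightarrow> Wset C (A k) s v \<noteq> {}"
    and S_ne: "S \<noteq> {}"
    and a: "a\<^sub>1 > 0" "a\<^sub>2 > 0" "a\<^sub>3 > 0" "a\<^sub>1 + a\<^sub>2 + a\<^sub>3 = 1"
    and r: "r\<^sub>0 > 0" "\<And>n. n \<ge> 1 \<Longrightarrow> r\<^sub>0 \<le> r n"
    and \<tau>_ge: "\<And>n. n \<ge> 1 \<Longrightarrow> \<tau>\<^sub>T n \<ge> 1" "\<And>n. n \<ge> 1 \<Longrightarrow> \<tau>\<^sub>A n \<ge> 1" "\<And>n. n \<ge> 1 \<Longrightarrow> \<tau>\<^sub>\<Theta> n \<ge> 1"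
    and \<tau>_inf: "\<And>m. m \<ge> 1 \<Longrightarrow> infinite {n. n \<ge> 1 \<and> \<tau>\<^sub>T n = m}"
      "\<And>m. m \<ge> 1 \<Longrightarrow> infinite {n. n \<ge> 1 \<and> \<tau>\<^sub>A n = m}"
      "\<And>m. m \<ge> 1 \<Longrightarrow> infinite {n. n \<ge> 1 \<and> \<tau>\<^sub>\<Theta> n = m}"
    and init: "x\<^sub>0 \<in> C" "x 1 = x\<^sub>0" "Cs 1 = C"
    and z: "\<And>n. n \<ge> 1 \<Longrightarrow> z n = resolvent_EP C (\<Theta> (\<tau>\<^sub>\<Theta> n)) (r n) (x n)"
    and u: "\<And>n. n \<ge> 1 \<Longrightarrow> u n = resolvent_VI C (A (\<tau>\<^sub>A n)) (r n) (x n)"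
    and y: "\<And>n. n \<ge> 1 \<Longrightarrow> y n =
      Jstar (a\<^sub>1 *\<^sub>R J (x n) + a\<^sub>2 *\<^sub>R J (z n) + a\<^sub>3 *\<^sub>R J (Jstar (T (\<tau>\<^sub>T n) (u n))))"
    and Cs: "\<And>n. n \<ge> 1 \<Longrightarrow> Cs (n + 1) = {v \<in> Cs n. phi v (y n) \<le> phi v (x n)}"
    and x: "\<And>n. n \<ge> 1 \<Longrightarrow> x (n + 1) = arg_min_on (\<lambda>v. phi v x\<^sub>0) (Cs (n + 1))"
  shows "\<exists>p\<in>S. x \<longlonglongrightarrow> p \<and> (\<forall>q\<in>S. phi p x\<^sub>0 \<le> phi q x\<^sub>0 \<and> (phi q x\<^sub>0 \<le> phi p x\<^sub>0 \<longrightarrow> q = p))"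
proof -
  define w where "w n = Jstar (T (\<tau>\<^sub>T n) (u n))" for n
  have S_FJ: "p \<in> FJ C (T j)" and S_EP: "p \<in> EP C (\<Theta> j)" and S_VI: "p \<in> VI C (A j)"
    if "p \<in> S" "j \<ge> 1" for p j
    using that by (auto simp: S_def common_solutions_def)
  have Jy: "J (y n) = a\<^sub>1 *\<^sub>R J (x n) + a\<^sub>2 *\<^sub>R J (z n) + a\<^sub>3 *\<^sub>R J (w n)" if "n \<ge> 1" for n
    unfolding y[OF that] w_def by (rule J_Jstar)
  have r_pos: "r n > 0" if "n \<ge> 1" for n using r(1) r(2)[OF that] by linarith
  have z_in: "z n \<in> Zset C (\<Theta> (\<tau>\<^sub>\<Theta> n)) (r n) (x n)" if "n \<ge> 1" "x n \<in> C" for n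
    unfolding z[OF that(1)]
    by (intro resolvent_EP_in_Zset[OF us uc] \<Theta> Z_ne \<tau>_ge r_pos that)
  have u_in: "u n \<in> Wset C (A (\<tau>\<^sub>A n)) (r n) (x n)" if "n \<ge> 1" "x n \<in> C" for n
    unfolding u[OF that(1)]
    by (intro resolvent_VI_in_Wset[OF us uc] A W_ne \<tau>_ge r_pos that)
  have uC: "u n \<in> C" if "n \<ge> 1" "x n \<in> C" for n using u_in[OF that] by (simp add: Wset_def)
  \<comment> \<open>The terms \<open>phi (z n) (x n)\<close> and \<open>phi (u n) (x n)\<close> are
    the slack of the two resolvents; \<open>w n\<close> inherits that of \<open>u n\<close> because
    the mapping does not increase \<open>phi p\<close>. They are kept since they later force
    \<open>z\<close> and \<open>u\<close> to converge.\<close>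
  have key: "phi p (y n) + a\<^sub>2 * phi (z n) (x n) + a\<^sub>3 * phi (u n) (x n) \<le> phi p (x n)"
    if n: "n \<ge> 1" "x n \<in> C" and p: "p \<in> S" for n p
  proof -
    have "phi p (z n) \<le> phi p (x n) - phi (z n) (x n)"
      using phi_Zset_le[OF us \<Theta>[OF \<tau>_ge(3)[OF n(1)]] r_pos[OF n(1)] z_in[OF n] S_EP[OF p \<tau>_ge(3)[OF n(1)]]]
      by simp
    moreover have "phi p (w n) \<le> phi p (x n) - phi (u n) (x n)"
      using phi_Wset_le[OF us A(2)[OF \<tau>_ge(2)[OF n(1)]] r_pos[OF n(1)] u_in[OF n] S_VI[OF p \<tau>_ge(2)[OF n(1)]]]
        T_phi[OF \<tau>_ge(1)[OF n(1)] uC[OF n] S_FJ[OF p \<tau>_ge(1)[OF n(1)]]]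
      by (simp add: w_def)
    ultimately have "a\<^sub>2 * phi p (z n) \<le> a\<^sub>2 * (phi p (x n) - phi (z n) (x n))"
        "a\<^sub>3 * phi p (w n) \<le> a\<^sub>3 * (phi p (x n) - phi (u n) (x n))"
      using a by (auto intro!: mult_left_mono)
    moreover have "phi p (y n) \<le> a\<^sub>1 * phi p (x n) + a\<^sub>2 * phi p (z n) + a\<^sub>3 * phi p (w n)"
      using a by (intro phi_J_convex_combination[OF us] Jy n) auto
    moreover have "a\<^sub>1 * phi p (x n) + a\<^sub>2 * phi p (x n) + a\<^sub>3 * phi p (x n) = phi p (x n)"
      by (simp only: a(4) mult_1 flip: distrib_right)
    ultimately show ?thesis by (simp only: right_diff_distrib)
  qed
  \<comment> \<open>One simultaneous induction: \<open>x n \<in> C\<close> makes the resolvents at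
    step \<open>n\<close> available, these keep \<open>S\<close> inside the next set, and
    nonemptiness of \<open>S\<close> lets the next projection exist.\<close>
  have inv: "S \<subseteq> Cs n \<and> closed (Cs n) \<and> convex (Cs n) \<and> Cs n \<subseteq> C \<and> x n \<in> Cs n
      \<and> (\<forall>v\<in>Cs n. phi v (x n) + phi (x n) x\<^sub>0 \<le> phi v x\<^sub>0)" if "n \<ge> 1" for n
    using that
  proof (induction n rule: dec_induct)
    case base
    have "S \<subseteq> C" using S_FJ[of _ 1] by (auto simp: FJ_def)
    then show ?case unfolding init(2,3) using init(1) C by (simp add: phi_self[OF us])
  next
    case (step n)
    then have n: "n \<ge> 1" "x n \<in> C" by auto
    have "phi p (y n) \<le> phi p (x n)" if "p \<in> S" for p
    proof -
      have "0 \<le> a\<^sub>2 * phi (z n) (x n)" "0 \<le> a\<^sub>3 * phi (u n) (x n)" using a by (auto simp: phi_nonneg[OF us])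
      with key[OF n that] show ?thesis by linarith
    qed
    then have sub: "S \<subseteq> Cs (n + 1)" using step.IH unfolding Cs[OF n(1)] by blast
    have eq: "Cs (n + 1) = Cs n \<inter> {v. phi v (y n) \<le> phi v (x n)}" unfolding Cs[OF n(1)] by auto
    have cl: "closed (Cs (n + 1))"
      unfolding eq using step.IH by (intro closed_Int closed_phi_le_phi[OF us]) blast
    have cv: "convex (Cs (n + 1))"
      unfolding eq using step.IH by (intro convex_Int convex_phi_le_phi[OF us]) blast
    have ne: "Cs (n + 1) \<noteq> {}" using sub S_ne by auto
    have "Cs (n + 1) \<subseteq> C" using step.IH unfolding eq by blast
    moreover note arg_min_phi[OF ne cl cv, where a = x\<^sub>0, folded x[OF n(1)]]
    ultimately show ?case
      unfolding Suc_eq_plus1 using sub cl cv by (intro conjI ballI)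
  qed
  have xC: "x n \<in> C" if "n \<ge> 1" for n using inv[OF that] by auto
  have S_Cs: "p \<in> Cs n" if "n \<ge> 1" "p \<in> S" for n p using inv[OF that(1)] that(2) by auto
  have three: "phi v (x n) + phi (x n) x\<^sub>0 \<le> phi v x\<^sub>0" if "n \<ge> 1" "v \<in> Cs n" for n v
    using inv[OF that(1)] that(2) by auto
  have Cs_anti: "Cs m \<subseteq> Cs n" if "n \<ge> 1" "n \<le> m" for n m
    using that(2)
  proof (induction m rule: dec_induct)
    case (step k)
    have "Cs (k + 1) \<subseteq> Cs k" using Cs[of k] step(1) that(1) by auto
    with step.IH show ?case by simp
  qed simp
  have x_Cs: "x m \<in> Cs n" if "n \<ge> 1" "n \<le> m" for n m
    using inv[of m] Cs_anti[OF that] that by auto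
  obtain q\<^sub>0 where q\<^sub>0: "q\<^sub>0 \<in> S" using S_ne by auto
  \<comment> \<open>The recursion starts at index 1 and leaves \<open>x 0\<close> unconstrained,
    hence the shift by \<open>Suc\<close>.\<close>
  define D where "D n = phi (x (Suc n)) x\<^sub>0" for n
  have x_diff: "phi (x (Suc m)) (x (Suc n)) \<le> D m - D n" if "n \<le> m" for n m
    using three[OF _ x_Cs, of "Suc n" "Suc m"] that by (simp add: D_def)
  have D_le: "D n \<le> phi q x\<^sub>0" if "q \<in> S" for n q
    using three[OF _ S_Cs[OF _ that], of "Suc n"] phi_nonneg[OF us, of q "x (Suc n)"] by (simp add: D_def)
  have "incseq D"
    using x_diff phi_nonneg[OF us] by (intro incseq_SucI) (metis diff_ge_0_iff_ge order_trans le_Suc_eq order_refl)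
  then obtain L where "D \<longlonglongrightarrow> L"
    using incseq_convergent[of D "phi q\<^sub>0 x\<^sub>0"] D_le[OF q\<^sub>0] by blast
  then have "convergent D" by (rule convergentI)
  then have "Cauchy D" by (rule convergent_Cauchy)
  have bounded: "norm (x (Suc n)) \<le> norm x\<^sub>0 + sqrt (phi q\<^sub>0 x\<^sub>0)" for n
  proof -
    have "(norm (x (Suc n)) - norm x\<^sub>0)\<^sup>2 \<le> phi q\<^sub>0 x\<^sub>0"
      using phi_ge[OF us, of "x (Suc n)" x\<^sub>0] D_le[OF q\<^sub>0, of n] by (simp add: D_def)
    from real_le_rsqrt[OF this] show ?thesis by simp
  qed
  have "Cauchy (\<lambda>n. x (Suc n))"
  proof (rule CauchyI')
    fix e :: real assume "e > 0"
    then obtain \<delta> where \<delta>: "\<delta> > 0" "\<And>v v' :: 'a. norm v' \<le> norm x\<^sub>0 + sqrt (phi q\<^sub>0 x\<^sub>0) \<Longrightarrow>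
        phi v v' < \<delta> \<Longrightarrow> norm (v - v') < e"
      using phi_small_imp_close[OF us uc \<open>e > 0\<close>] by blast
    obtain N where N: "\<And>m n. m \<ge> N \<Longrightarrow> n \<ge> N \<Longrightarrow> norm (D m - D n) < \<delta>"
      using CauchyD[OF \<open>Cauchy D\<close> \<delta>(1)] by blast
    have "dist (x (Suc m)) (x (Suc n)) < e" if "m \<ge> N" "n > m" for m n
    proof -
      have "phi (x (Suc n)) (x (Suc m)) < \<delta>"
        using x_diff[of m n] N[of n m] that by simp
      from \<delta>(2)[OF bounded this] show ?thesis by (simp add: dist_norm norm_minus_commute)
    qed
    then show "\<exists>N. \<forall>m\<ge>N. \<forall>n>m. dist (x (Suc m)) (x (Suc n)) < e" by blast
  qed
  then obtain p where "(\<lambda>n. x (Suc n)) \<longlonglongrightarrow> p"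
    by (auto simp: Cauchy_convergent_iff convergent_def)
  then have x_lim: "x \<longlonglongrightarrow> p" by (rule LIMSEQ_imp_Suc)
  have p_Cs: "p \<in> Cs n" if "n \<ge> 1" for n
  proof (rule closed_sequentially)
    show "closed (Cs n)" using inv[OF that] by simp
    show "x (k + n) \<in> Cs n" for k using x_Cs[of n "k + n"] that by simp
    show "(\<lambda>k. x (k + n)) \<longlonglongrightarrow> p" by (rule LIMSEQ_ignore_initial_segment[OF x_lim])
  qed
  have pC: "p \<in> C" using p_Cs[of 1] init by simp
  have x_lim': "(\<lambda>n. x (n + 1)) \<longlonglongrightarrow> p" by (rule LIMSEQ_ignore_initial_segment[OF x_lim])
  have ev1: "\<forall>\<^sub>F n::nat in sequentially. n \<ge> 1" by (rule eventually_ge_at_top)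
  have step_lim: "(\<lambda>n. phi (x (n + 1)) (x n)) \<longlonglongrightarrow> 0"
    using phi_tendsto[OF us x_lim' x_lim] by (simp add: phi_self[OF us])
  \<comment> \<open>\<open>x (n + 1)\<close> lies in \<open>Cs (n + 1)\<close>, whose defining
    inequality transfers the smallness of \<open>phi (x (n + 1)) (x n)\<close> to
    \<open>y n\<close>.\<close>
  have "(\<lambda>n. phi (x (n + 1)) (y n)) \<longlonglongrightarrow> 0"
  proof (rule tendsto_sandwich[OF _ _ tendsto_const step_lim])
    show "\<forall>\<^sub>F n in sequentially. phi (x (n + 1)) (y n) \<le> phi (x (n + 1)) (x n)"
      using ev1
    proof eventually_elim
      case (elim n)
      then have "x (n + 1) \<in> Cs (n + 1)" using x_Cs[of "n + 1" "n + 1"] by simp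
      then show ?case unfolding Cs[OF elim] by simp
    qed
  qed (simp add: phi_nonneg[OF us])
  then have y_lim: "y \<longlonglongrightarrow> p" by (rule phi_tendsto_0_imp_tendsto_right[OF us uc _ x_lim'])
  \<comment> \<open>\<open>x\<close> and \<open>y\<close> share the limit \<open>p\<close>, so the
    room left in \<open>key\<close> for the fixed \<open>q\<^sub>0\<close> closes; \<open>c\<close>
    will be the weight of the slack term.\<close>
  have gap: "(\<lambda>n. (phi q\<^sub>0 (x n) - phi q\<^sub>0 (y n)) / c) \<longlonglongrightarrow> 0" for c
  proof -
    have "(\<lambda>n. (phi q\<^sub>0 (x n) - phi q\<^sub>0 (y n)) * inverse c) \<longlonglongrightarrow> (phi q\<^sub>0 p - phi q\<^sub>0 p) * inverse c"
      by (intro tendsto_mult tendsto_diff phi_tendsto[OF us] tendsto_const x_lim y_lim)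
    then show ?thesis by (simp add: divide_inverse)
  qed
  have zu_le: "a\<^sub>2 * phi (z n) (x n) \<le> phi q\<^sub>0 (x n) - phi q\<^sub>0 (y n)"
    "a\<^sub>3 * phi (u n) (x n) \<le> phi q\<^sub>0 (x n) - phi q\<^sub>0 (y n)" if "n \<ge> 1" for n
  proof -
    have "0 \<le> a\<^sub>2 * phi (z n) (x n)" "0 \<le> a\<^sub>3 * phi (u n) (x n)" using a by (auto simp: phi_nonneg[OF us])
    with key[OF that xC[OF that] q\<^sub>0]
    show "a\<^sub>2 * phi (z n) (x n) \<le> phi q\<^sub>0 (x n) - phi q\<^sub>0 (y n)"
      "a\<^sub>3 * phi (u n) (x n) \<le> phi q\<^sub>0 (x n) - phi q\<^sub>0 (y n)" by linarith+
  qed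
  have "(\<lambda>n. phi (z n) (x n)) \<longlonglongrightarrow> 0"
  proof (rule tendsto_sandwich[OF _ _ tendsto_const gap[of a\<^sub>2]])
    show "\<forall>\<^sub>F n in sequentially. phi (z n) (x n) \<le> (phi q\<^sub>0 (x n) - phi q\<^sub>0 (y n)) / a\<^sub>2"
      using ev1 by eventually_elim (use zu_le(1) a in \<open>simp add: pos_le_divide_eq mult.commute\<close>)
  qed (simp add: phi_nonneg[OF us])
  then have z_lim: "z \<longlonglongrightarrow> p" by (rule phi_tendsto_0_imp_tendsto[OF us uc _ x_lim])
  have "(\<lambda>n. phi (u n) (x n)) \<longlonglongrightarrow> 0"
  proof (rule tendsto_sandwich[OF _ _ tendsto_const gap[of a\<^sub>3]])
    show "\<forall>\<^sub>F n in sequentially. phi (u n) (x n) \<le> (phi q\<^sub>0 (x n) - phi q\<^sub>0 (y n)) / a\<^sub>3"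
      using ev1 by eventually_elim (use zu_le(2) a in \<open>simp add: pos_le_divide_eq mult.commute\<close>)
  qed (simp add: phi_nonneg[OF us])
  then have u_lim: "u \<longlonglongrightarrow> p" by (rule phi_tendsto_0_imp_tendsto[OF us uc _ x_lim])
  have "(\<lambda>n. (1 / a\<^sub>3) *\<^sub>R (J (y n) - a\<^sub>1 *\<^sub>R J (x n) - a\<^sub>2 *\<^sub>R J (z n)))
      \<longlonglongrightarrow> (1 / a\<^sub>3) *\<^sub>R (J p - a\<^sub>1 *\<^sub>R J p - a\<^sub>2 *\<^sub>R J p)"
    by (intro tendsto_scaleR tendsto_diff tendsto_const J_tendsto[OF us] x_lim y_lim z_lim)
  moreover have "(1 / a\<^sub>3) *\<^sub>R (J p - a\<^sub>1 *\<^sub>R J p - a\<^sub>2 *\<^sub>R J p) = J p"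
  proof -
    have "J p - a\<^sub>1 *\<^sub>R J p - a\<^sub>2 *\<^sub>R J p = (1 - a\<^sub>1 - a\<^sub>2) *\<^sub>R J p" by (simp add: scaleR_diff_left)
    also have "1 - a\<^sub>1 - a\<^sub>2 = a\<^sub>3" using a(4) by simp
    finally show ?thesis using a(3) by simp
  qed
  moreover have "\<forall>\<^sub>F n in sequentially. (1 / a\<^sub>3) *\<^sub>R (J (y n) - a\<^sub>1 *\<^sub>R J (x n) - a\<^sub>2 *\<^sub>R J (z n)) = J (w n)"
    using ev1 by eventually_elim (use a(3) in \<open>simp add: Jy\<close>)
  ultimately have "(\<lambda>n. J (w n)) \<longlonglongrightarrow> J p" by (simp add: tendsto_cong)
  then have w_lim: "w \<longlonglongrightarrow> p" by (rule tendsto_of_J_tendsto)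
  have p_FJ: "p \<in> FJ C (T j)" if j: "j \<ge> 1" for j
  proof -
    \<comment> \<open>The index \<open>j\<close> is visited infinitely often, so a subsequence uses
      the single mapping \<open>T j\<close>, whose closedness then applies. The other two families
      are treated alike.\<close>
    obtain \<sigma> :: "nat \<Rightarrow> nat" where \<sigma>: "strict_mono \<sigma>" "\<And>k. \<sigma> k \<ge> 1" "\<And>k. \<tau>\<^sub>T (\<sigma> k) = j"
      using infinite_enumerate[OF \<tau>_inf(1)[OF j]] by auto
    have "(\<lambda>k. u (\<sigma> k)) \<longlonglongrightarrow> p" "(\<lambda>k. Jstar (T j (u (\<sigma> k)))) \<longlonglongrightarrow> p"
      using LIMSEQ_subseq_LIMSEQ[OF u_lim \<sigma>(1)] LIMSEQ_subseq_LIMSEQ[OF w_lim \<sigma>(1)]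
      by (simp_all add: o_def w_def \<sigma>(3))
    moreover have "u (\<sigma> k) \<in> C" for k using uC xC \<sigma>(2) by blast
    ultimately have "p = Jstar (T j p)"
      using T_closed[OF j, unfolded Jstar_closed_def, THEN conjunct2, rule_format, of "\<lambda>k. u (\<sigma> k)" p p] pC
      by simp
    then have "J p = T j p" using J_Jstar[of "T j p"] by simp
    then show ?thesis using pC by (simp add: FJ_def)
  qed
  have p_EP: "p \<in> EP C (\<Theta> l)" if l: "l \<ge> 1" for l
  proof -
    obtain \<sigma> :: "nat \<Rightarrow> nat" where \<sigma>: "strict_mono \<sigma>" "\<And>k. \<sigma> k \<ge> 1" "\<And>k. \<tau>\<^sub>\<Theta> (\<sigma> k) = l"
      using infinite_enumerate[OF \<tau>_inf(3)[OF l]] by auto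
    show ?thesis
    proof (rule limit_of_resolvents_in_EP[OF us \<Theta>[OF l] C(2) pC r(1)])
      show "r\<^sub>0 \<le> r (\<sigma> k)" for k using r(2) \<sigma>(2) by blast
      show "z (\<sigma> k) \<in> Zset C (\<Theta> l) (r (\<sigma> k)) (x (\<sigma> k))" for k
        using z_in[OF \<sigma>(2) xC[OF \<sigma>(2)], of k] by (simp add: \<sigma>(3))
      show "(\<lambda>k. z (\<sigma> k)) \<longlonglongrightarrow> p" "(\<lambda>k. x (\<sigma> k)) \<longlonglongrightarrow> p"
        using LIMSEQ_subseq_LIMSEQ[OF z_lim \<sigma>(1)] LIMSEQ_subseq_LIMSEQ[OF x_lim \<sigma>(1)] by (simp_all add: o_def)
    qed
  qed
  have p_VI: "p \<in> VI C (A k)" if k: "k \<ge> 1" for k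
  proof -
    obtain \<sigma> :: "nat \<Rightarrow> nat" where \<sigma>: "strict_mono \<sigma>" "\<And>i. \<sigma> i \<ge> 1" "\<And>i. \<tau>\<^sub>A (\<sigma> i) = k"
      using infinite_enumerate[OF \<tau>_inf(2)[OF k]] by auto
    show ?thesis
    proof (rule limit_of_resolvents_in_VI[OF us A(1)[OF k] pC r(1)])
      show "r\<^sub>0 \<le> r (\<sigma> i)" for i using r(2) \<sigma>(2) by blast
      show "u (\<sigma> i) \<in> Wset C (A k) (r (\<sigma> i)) (x (\<sigma> i))" for i
        using u_in[OF \<sigma>(2) xC[OF \<sigma>(2)], of i] by (simp add: \<sigma>(3))
      show "(\<lambda>i. u (\<sigma> i)) \<longlonglongrightarrow> p" "(\<lambda>i. x (\<sigma> i)) \<longlonglongrightarrow> p"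
        using LIMSEQ_subseq_LIMSEQ[OF u_lim \<sigma>(1)] LIMSEQ_subseq_LIMSEQ[OF x_lim \<sigma>(1)] by (simp_all add: o_def)
    qed
  qed
  have pS: "p \<in> S" using p_FJ p_EP p_VI by (simp add: S_def common_solutions_def)
  \<comment> \<open>The three-point inequality survives the limit. It gives minimality of
    \<open>p\<close> and forces \<open>phi q p = 0\<close> for any other minimizer
    \<open>q\<close>.\<close>
  have limit_ineq: "phi q p + phi p x\<^sub>0 \<le> phi q x\<^sub>0" if "q \<in> S" for q
  proof (rule LIMSEQ_le_const2)
    show "(\<lambda>n. phi q (x n) + phi (x n) x\<^sub>0) \<longlonglongrightarrow> phi q p + phi p x\<^sub>0"
      by (intro tendsto_add phi_tendsto[OF us] tendsto_const x_lim)
    show "\<exists>N. \<forall>n\<ge>N. phi q (x n) + phi (x n) x\<^sub>0 \<le> phi q x\<^sub>0"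
      using three S_Cs that by blast
  qed
  have "phi p x\<^sub>0 \<le> phi q x\<^sub>0 \<and> (phi q x\<^sub>0 \<le> phi p x\<^sub>0 \<longrightarrow> q = p)" if "q \<in> S" for q
    using limit_ineq[OF that] phi_nonneg[OF us, of q p] phi_eq_0_iff[OF us uc, of q p] by auto
  with pS x_lim show ?thesis by blast
qed

end

section \<open>The Bregman setting for half the squared norm\<close>

theorem corollary3p5:
  fixes C :: "'a::banach set" and g :: "'a \<Rightarrow> real"
  assumes "uniformly_convex TYPE('a)" and "uniformly_smooth TYPE('a)"
    and "C \<noteq> {}" and "closed C" and "convex C"
    and "g = (\<lambda>x. (1/2) * (norm x)\<^sup>2)"
  shows
    "(\<forall>x. g differentiable (at x) \<and> gradient g x = J x) \<and>
     (\<forall>x y. bregman g x y = (1/2) * phi x y) \<and>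
     (\<forall>T :: 'a \<Rightarrow> ('a \<Rightarrow>\<^sub>L real). (\<forall>x\<in>C. Jstar (T x) \<in> C) \<and> FJ C T \<noteq> {} \<longrightarrow>
        (gen_bregman_nonexpansive g C T \<longleftrightarrow>
           (\<forall>x\<in>C. \<forall>p\<in>FJ C T. phi p (Jstar (T x)) \<le> phi p x))) \<and>
     (\<forall>(\<Theta> :: nat \<Rightarrow> 'a \<Rightarrow> 'a \<Rightarrow> real) (A :: nat \<Rightarrow> 'a \<Rightarrow> ('a \<Rightarrow>\<^sub>L real)) (T :: nat \<Rightarrow> 'a \<Rightarrow> ('a \<Rightarrow>\<^sub>L real))
        (\<alpha>\<^sub>1 :: real) (\<alpha>\<^sub>2 :: real) (\<alpha>\<^sub>3 :: real) (r\<^sub>0 :: real) (r :: nat \<Rightarrow> real)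
        (\<tau>\<^sub>T :: nat \<Rightarrow> nat) (\<tau>\<^sub>A :: nat \<Rightarrow> nat) (\<tau>\<^sub>\<Theta> :: nat \<Rightarrow> nat)
        (x\<^sub>0 :: 'a) (x :: nat \<Rightarrow> 'a) (z :: nat \<Rightarrow> 'a) (u :: nat \<Rightarrow> 'a) (y :: nat \<Rightarrow> 'a) (Cs :: nat \<Rightarrow> 'a set).
        (\<forall>l\<ge>1. equilibrium_bifunction C (\<Theta> l)) \<and>
        (\<forall>k\<ge>1. continuous_on C (A k) \<and> monotone_mapping C (A k)) \<and>
        (\<forall>j\<ge>1. Jstar_closed C (T j) \<and> (\<forall>v\<in>C. Jstar (T j v) \<in> C) \<and> FJ C (T j) \<noteq> {} \<and>
           (\<forall>v\<in>C. \<forall>p\<in>FJ C (T j). phi p (Jstar (T j v)) \<le> phi p v)) \<and>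
        (\<forall>l\<ge>1. \<forall>v\<in>C. \<forall>s>0. Zset C (\<Theta> l) s v \<noteq> {}) \<and>
        (\<forall>k\<ge>1. \<forall>v\<in>C. \<forall>s>0. Wset C (A k) s v \<noteq> {}) \<and>
        common_solutions C T \<Theta> A \<noteq> {} \<and>
        \<alpha>\<^sub>1 \<in> {0<..<1} \<and> \<alpha>\<^sub>2 \<in> {0<..<1} \<and> \<alpha>\<^sub>3 \<in> {0<..<1} \<and> \<alpha>\<^sub>1 + \<alpha>\<^sub>2 + \<alpha>\<^sub>3 = 1 \<and>
        r\<^sub>0 > 0 \<and> (\<forall>n\<ge>1. r n \<ge> r\<^sub>0) \<and>
        (\<forall>\<tau>\<in>{\<tau>\<^sub>T, \<tau>\<^sub>A, \<tau>\<^sub>\<Theta>}. (\<forall>n\<ge>1. \<tau> n \<ge> 1) \<and> (\<forall>m\<ge>1. infinite {n. n \<ge> 1 \<and> \<tau> n = m})) \<and>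
        x\<^sub>0 \<in> C \<and> x 1 = x\<^sub>0 \<and> Cs 1 = C \<and>
        (\<forall>n\<ge>1.
           z n = resolvent_EP C (\<Theta> (\<tau>\<^sub>\<Theta> n)) (r n) (x n) \<and>
           u n = resolvent_VI C (A (\<tau>\<^sub>A n)) (r n) (x n) \<and>
           y n = Jstar (\<alpha>\<^sub>1 *\<^sub>R J (x n) + \<alpha>\<^sub>2 *\<^sub>R J (z n) + \<alpha>\<^sub>3 *\<^sub>R J (Jstar (T (\<tau>\<^sub>T n) (u n)))) \<and>
           Cs (n + 1) = {v \<in> Cs n. phi v (y n) \<le> phi v (x n)} \<and>
           x (n + 1) = arg_min_on (\<lambda>v. phi v x\<^sub>0) (Cs (n + 1)))
        \<longrightarrow>
        (\<exists>p. is_arg_min (\<lambda>v. phi v x\<^sub>0) (\<lambda>v. v \<in> common_solutions C T \<Theta> A) p \<and>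
             (\<forall>q. is_arg_min (\<lambda>v. phi v x\<^sub>0) (\<lambda>v. v \<in> common_solutions C T \<Theta> A) q \<longrightarrow> q = p) \<and>
             x \<longlonglongrightarrow> p))"
proof -
  note uc = assms(1) and us = assms(2) and g = assms(6)
  have gradient: "\<forall>x. g differentiable (at x) \<and> gradient g x = J x"
    unfolding g using duality_set_has_derivative[OF us J_in_duality_set[OF us]] gradient_half_square[OF us]
    by (auto intro: differentiableI)
  have bregman: "\<forall>x y. bregman g x y = (1/2) * phi x y"
    unfolding g using bregman_half_square[OF us] by blast
  have nonexpansive: "\<forall>T :: 'a \<Rightarrow> ('a \<Rightarrow>\<^sub>L real). (\<forall>x\<in>C. Jstar (T x) \<in> C) \<and> FJ C T \<noteq> {} \<longrightarrow>
      (gen_bregman_nonexpansive g C T \<longleftrightarrow>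
        (\<forall>x\<in>C. \<forall>p\<in>FJ C T. phi p (Jstar (T x)) \<le> phi p x))"
    by (simp add: gen_bregman_nonexpansive_def bregman[rule_format])
  show ?thesis
  proof (rule conjI[OF gradient conjI[OF bregman conjI[OF nonexpansive]]], intro allI impI,
      elim conjE, goal_cases)
    case H: (1 \<Theta> A T \<alpha>\<^sub>1 \<alpha>\<^sub>2 \<alpha>\<^sub>3 r\<^sub>0 r \<tau>\<^sub>T \<tau>\<^sub>A \<tau>\<^sub>\<Theta> x\<^sub>0 x z u y Cs)
    have "\<exists>p\<in>common_solutions C T \<Theta> A. x \<longlonglongrightarrow> p \<and> (\<forall>q\<in>common_solutions C T \<Theta> A.
        phi p x\<^sub>0 \<le> phi q x\<^sub>0 \<and> (phi q x\<^sub>0 \<le> phi p x\<^sub>0 \<longrightarrow> q = p))"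
    proof (rule hybrid_projection_tendsto[OF us uc \<open>closed C\<close> \<open>convex C\<close>])
      show "equilibrium_bifunction C (\<Theta> l)" if "l \<ge> 1" for l using H(1) that by blast
      show "continuous_on C (A k)" "monotone_mapping C (A k)" if "k \<ge> 1" for k
        using H(2) that by blast+
      show "Jstar_closed C (T j)" if "j \<ge> 1" for j using H(3) that by blast
      show "phi p (Jstar (T j v)) \<le> phi p v" if "j \<ge> 1" "v \<in> C" "p \<in> FJ C (T j)" for j v p
        using H(3) that by blast
      show "Zset C (\<Theta> l) s v \<noteq> {}" if "l \<ge> 1" "v \<in> C" "s > 0" for l v s using H(4) that by blast
      show "Wset C (A k) s v \<noteq> {}" if "k \<ge> 1" "v \<in> C" "s > 0" for k v s using H(5) that by blast
      show "\<alpha>\<^sub>1 > 0" "\<alpha>\<^sub>2 > 0" "\<alpha>\<^sub>3 > 0" using H(7-9) by auto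
      show "r\<^sub>0 \<le> r n" if "n \<ge> 1" for n using H(12) that by blast
      show "\<tau>\<^sub>T n \<ge> 1" "\<tau>\<^sub>A n \<ge> 1" "\<tau>\<^sub>\<Theta> n \<ge> 1" if "n \<ge> 1" for n using H(13) that by blast+
      show "infinite {n. n \<ge> 1 \<and> \<tau>\<^sub>T n = m}" "infinite {n. n \<ge> 1 \<and> \<tau>\<^sub>A n = m}"
        "infinite {n. n \<ge> 1 \<and> \<tau>\<^sub>\<Theta> n = m}" if "m \<ge> 1" for m using H(13) that by blast+
      fix n :: nat assume "n \<ge> 1"
      note step = H(17)[rule_format, OF this]
      show "z n = resolvent_EP C (\<Theta> (\<tau>\<^sub>\<Theta> n)) (r n) (x n)"
        and "u n = resolvent_VI C (A (\<tau>\<^sub>A n)) (r n) (x n)"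
        and "y n = Jstar (\<alpha>\<^sub>1 *\<^sub>R J (x n) + \<alpha>\<^sub>2 *\<^sub>R J (z n) + \<alpha>\<^sub>3 *\<^sub>R J (Jstar (T (\<tau>\<^sub>T n) (u n))))"
        and "Cs (n + 1) = {v \<in> Cs n. phi v (y n) \<le> phi v (x n)}"
        and "x (n + 1) = arg_min_on (\<lambda>v. phi v x\<^sub>0) (Cs (n + 1))"
        using step by blast+
    qed (fact H(6) H(10) H(11) H(14) H(15) H(16))+
    \<comment> \<open>For real values \<open>is_arg_min\<close> means membership with least value,
      so a second minimizer \<open>q\<close> satisfies
      \<open>phi q x\<^sub>0 \<le> phi p x\<^sub>0\<close> and equals \<open>p\<close>.\<close>
    then show ?case unfolding is_arg_min_linorder by blast
  qed
qed

end
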